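(* Let $A_0,A_1$ be real $2\times 2$ matrices satisfying conditions (A1)-(A3) of the context, and let $\mu_f$ be the associated probability measure. Consider the conditions (i) $(c_0+d_0-2a_0)(d_0-a_0)=a_0c_0$, (ii) $(a_1-2c_1)(d_1-2b_1)=b_1c_1$. Then: (1) If both (i) and (ii) are satisfied, then $\mu_f(dx)=\dfrac{1+2c_0}{(-2c_0x+1+2c_0)^2}\,dx$. In particular, $\mu_f$ is absolutely continuous. (2) If either (i) or (ii) fails, then there exists a Borel set $K_1$ such that $\mu_f(K_1)=1$ and $\dim_H(K_1)<1$. In particular, $\mu_f$ is singular.
   Context: For a real $2\times2$ matrix $A=\begin{pmatrix} a&b\\c&d\end{pmatrix}$ and $z\in\mathbb{R}$ put $\Phi(A;z)=\frac{az+b}{cz+d}$. The matrices $A_i=\begin{pmatrix} a_i&b_i\\c_i&d_i\end{pmatrix}$, $i=0,1$, satisfy: (A1) $0=b_0<\frac{a_0+b_0}{c_0+d_0}=\frac{b_1}{d_1}<\frac{a_1+b_1}{c_1+d_1}=1$; (A2) $a_id_i-b_ic_i>0$, $i=0,1$; (A3) $(a_id_i-b_ic_i)^{1/2}<\min\{d_i,c_i+d_i\}$, $i=0,1$. Under these conditions $F_i=\Phi(A_i;\cdot)$ are strictly increasing contractions of $[0,1]$ with $0=F_0(0)<F_0(1)=F_1(0)<F_1(1)=1$, and (de Rham) there is a unique continuous strictly increasing $f:[0,1]\to[0,1]$ with $f(x)=F_0(f(2x))$ for $0\le x\le 1/2$ and $f(x)=F_1(f(2x-1))$ for $1/2\le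 x\le 1$. $\mu_f$ is the Borel probability measure on $[0,1]$ whose distribution function is $f$. Absolute continuity and singularity are with respect to Lebesgue measure, and $\dim_H$ denotes Hausdorff dimension.
   Formalization: In part (1) the density is stated with c_0/d_0 in place of c_0, since the printed formula is correct only when d_0 = 1 or c_0 = 0 (it fails e.g. for A_0 = (1 0; 1 2), A_1 = (3 1; 1 3)). *)

theory Defs
  imports "HOL-Analysis.Analysis"
begin

definition Phi :: "real^2^2 \<Rightarrow> real \<Rightarrow> real" where
  "Phi A z = (A $ 1 $ 1 * z + A $ 1 $ 2) / (A $ 2 $ 1 * z + A $ 2 $ 2)"

text \<open>Only the values of \<open>f\<close> on \<open>[0,1]\<close> are constrained; under (A1)-(A3) they are uniquely
  determined (de Rham).\<close>

definition de_rham_function :: "real^2^2 \<Rightarrow> real^2^2 \<Rightarrow> (real \<Rightarrow> real) \<Rightarrow> bool" where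
  "de_rham_function A0 A1 f \<longleftrightarrow>
     f ` {0..1} \<subseteq> {0..1} \<and> continuous_on {0..1} f \<and> strict_mono_on {0..1} f \<and>
     (\<forall>x. 0 \<le> x \<and> x \<le> 1/2 \<longrightarrow> f x = Phi A0 (f (2 * x))) \<and>
     (\<forall>x. 1/2 \<le> x \<and> x \<le> 1 \<longrightarrow> f x = Phi A1 (f (2 * x - 1)))"

text \<open>The Borel measure on \<open>[0,1]\<close> with distribution function \<open>f\<close>; see \<open>emeasure_mu_of_Icc\<close>.\<close>

definition mu_of :: "(real \<Rightarrow> real) \<Rightarrow> real measure" where
  "mu_of f = restrict_space
     (interval_measure (\<lambda>x. if x < 0 then 0 else if x \<le> 1 then f x else 1)) {0..1}"

abbreviation lborel01 :: "real measure" where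
  "lborel01 \<equiv> restrict_space lborel {0..1}"

definition mutually_singular :: "'a measure \<Rightarrow> 'a measure \<Rightarrow> bool" where
  "mutually_singular M N \<longleftrightarrow>
     sets M = sets N \<and> (\<exists>S\<in>sets M. emeasure M S = 0 \<and> emeasure N (space N - S) = 0)"

text \<open>\<open>diam(U)\<^sup>s\<close> for bounded \<open>U\<close>, with the usual conventions for \<open>U = {}\<close> and \<open>s = 0\<close>
  (note that \<open>0 powr 0 = 0\<close>).\<close>

definition diam_pow :: "real \<Rightarrow> 'a::metric_space set \<Rightarrow> ennreal" where
  "diam_pow s U = (if U = {} then 0 else if s = 0 then 1 else ennreal (diameter U powr s))"

definition hausdorff_pre :: "real \<Rightarrow> real \<Rightarrow> 'a::metric_space set \<Rightarrow> ennreal" where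
  "hausdorff_pre s \<delta> E =
     (INF U \<in> {U :: nat \<Rightarrow> 'a set. E \<subseteq> (\<Union>n. U n) \<and> (\<forall>n. bounded (U n) \<and> diameter (U n) \<le> \<delta>)}.
        \<Sum>n. diam_pow s (U n))"

definition hausdorff_measure :: "real \<Rightarrow> 'a::metric_space set \<Rightarrow> ennreal" where
  "hausdorff_measure s E = (SUP \<delta> \<in> {0<..}. hausdorff_pre s \<delta> E)"

definition hausdorff_dim :: "'a::metric_space set \<Rightarrow> ennreal" where
  "hausdorff_dim E = (INF s \<in> {s. 0 \<le> s \<and> hausdorff_measure s E = 0}. ennreal s)"

lemma sets_mu_of: "sets (mu_of f) = sets lborel01"
  by (simp add: mu_of_def sets_restrict_space)

lemma emeasure_mu_of_Icc:
  assumes "continuous_on {0..1} f" "mono_on {0..1} f" "f 0 = 0" "f 1 = 1" "0 \<le> x" "x \<le> 1"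
  shows "emeasure (mu_of f) {0..x} = ennreal (f x)"
proof -
  define F where "F = (\<lambda>x. if x < 0 then 0 else if x \<le> 1 then f x else 1)"
  have F_eq: "F y = f (min 1 (max 0 y))" for y
    using assms(3,4) by (auto simp: F_def)
  have mono: "F y \<le> F z" if "y \<le> z" for y z
    unfolding F_eq using that by (intro mono_onD[OF assms(2)]) auto
  have "continuous_on UNIV (\<lambda>y. f (min 1 (max 0 y)))"
    by (rule continuous_on_compose2[OF assms(1)]) (auto intro!: continuous_intros)
  then have cont: "continuous_on UNIV F"
    unfolding F_eq[abs_def] .
  have "emeasure (mu_of f) {0..x} = emeasure (interval_measure F) {0..x}"
    unfolding mu_of_def F_def[symmetric] using assms(5,6)
    by (intro emeasure_restrict_space) auto
  also have "\<dots> = ennreal (F x - F 0)"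
    using assms(5) mono continuous_on_subset[OF cont]
    by (intro emeasure_interval_measure_Icc) auto
  finally show ?thesis
    using assms by (simp add: F_def)
qed

end

(*
  Write mob u z = u z / (1 - z + u z) and t = F_0(1). Then F_0 = t mob k0 and
  F_1 = t + (1 - t) mob k1. Conjugating, f restricted to a dyadic interval and rescaled to [0,1] is
  mob u o f for a state u > 0, and passing to the two halves multiplies masses by mob u t and
  1 - mob u t while u moves to H0 u or H1 u. Condition (i) says that H0 fixes the state with
  mob u t = 1/2, condition (ii) that H1 does.

  If both hold, a single Moebius map solves the functional equation, and F_0, F_1 are contractions,
  so f is that map. Otherwise, since sqrt p + sqrt (1 - p) <= sqrt 2 with equality only at p = 1/2,
  two consecutive subdivisions multiply the sum of the square roots of the masses by less than 2,
  uniformly on a compact invariant set of states. Hence this sum is at most (2 L)^n over the 4^n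
  intervals of level 2n, with L < 1, so most of the mass sits on at most (4 L)^n of them.
*)

theory Submission
  imports Defs
begin

section \<open>Covers of limit superior sets\<close>

lemma mem_limsup_iff: "x \<in> limsup A \<longleftrightarrow> (\<forall>n. \<exists>m\<ge>n. x \<in> A m)" for A :: "nat \<Rightarrow> 'a set"
  by (auto simp: limsup_INF_SUP)

lemma hausdorff_pre_le:
  assumes "E \<subseteq> (\<Union>n. U n)" "\<And>n. bounded (U n)" "\<And>n. diameter (U n) \<le> \<delta>"
  shows "hausdorff_pre s \<delta> E \<le> (\<Sum>n. diam_pow s (U n))"
  unfolding hausdorff_pre_def by (rule INF_lower) (use assms in auto)

text \<open>A point of the limsup lies in sets of arbitrarily late stages, so for every
  \<open>m\<close> the stages from \<open>m\<close> on still cover \<open>K\<close>. Their diameters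
  are small, and their total cost is at most a tail of the convergent series of
  \<open>c\<close>.\<close>

lemma hausdorff_measure_limsup_eq_0:
  fixes I :: "nat \<Rightarrow> nat \<Rightarrow> 'a::metric_space set" and W :: "nat \<Rightarrow> nat set"
  assumes K: "K \<subseteq> limsup (\<lambda>n. \<Union>j\<in>W n. I n j)"
    and fin: "\<And>n. finite (W n)"
    and bnd: "\<And>n j. j \<in> W n \<Longrightarrow> bounded (I n j)"
    and diam: "\<And>n j. j \<in> W n \<Longrightarrow> diameter (I n j) \<le> r n"
    and r: "r \<longlonglongrightarrow> 0"
    and le: "\<And>n. (\<Sum>j\<in>W n. diam_pow s (I n j)) \<le> ennreal (c n)"
    and c: "summable c" "\<And>n. 0 \<le> c n"
  shows "hausdorff_measure s K = 0"
proof -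
  have pre_le: "hausdorff_pre s \<delta> K \<le> ennreal \<epsilon>" if "\<delta> > 0" "\<epsilon> > 0" for \<delta> \<epsilon>
  proof -
    obtain m1 where m1: "\<And>n. n \<ge> m1 \<Longrightarrow> r n < \<delta>"
      using order_tendstoD(2)[OF r \<open>\<delta> > 0\<close>] by (auto simp: eventually_sequentially)
    obtain m2 where m2: "\<And>n. n \<ge> m2 \<Longrightarrow> norm (\<Sum>i. c (i + n)) < \<epsilon>"
      using suminf_exist_split[OF \<open>\<epsilon> > 0\<close> c(1)] by blast
    define m where "m = max m1 m2"
    define V where "V = (\<lambda>(n, j). if m \<le> n \<and> j \<in> W n then I n j else {})"
    have "K \<subseteq> (\<Union>k. V (prod_decode k))"
    proof
      fix x assume "x \<in> K"
      then obtain n j where nj: "n \<ge> m" "j \<in> W n" "x \<in> I n j"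
        using K unfolding subset_iff mem_limsup_iff UN_iff by meson
      then have "x \<in> V (prod_decode (prod_encode (n, j)))"
        by (simp add: V_def)
      then show "x \<in> (\<Union>k. V (prod_decode k))" by blast
    qed
    moreover have "bounded (V p)" "diameter (V p) \<le> \<delta>" for p
    proof -
      show "bounded (V p)"
        using bnd by (auto simp: V_def split: prod.split)
      have "diameter (I n j) \<le> \<delta>" if "m \<le> n" "j \<in> W n" for n j
        using diam[OF that(2)] m1[of n] that(1) by (simp add: m_def)
      then show "diameter (V p) \<le> \<delta>"
        using \<open>\<delta> > 0\<close> by (auto simp: V_def split: prod.split)
    qed
    ultimately have "hausdorff_pre s \<delta> K \<le> (\<Sum>k. diam_pow s (V (prod_decode k)))"
      by (intro hausdorff_pre_le)
    also have "\<dots> = (\<Sum>n. \<Sum>j. diam_pow s (V (n, j)))"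
      by (rule suminf_ennreal_2dimen) simp
    also have "\<dots> \<le> (\<Sum>n. ennreal (if n < m then 0 else c n))"
    proof (intro suminf_le allI)
      fix n
      have "(\<Sum>j. diam_pow s (V (n, j))) = (\<Sum>j\<in>W n. diam_pow s (V (n, j)))"
        by (rule suminf_finite[OF fin]) (auto simp: V_def diam_pow_def)
      also have "\<dots> = (if n < m then 0 else (\<Sum>j\<in>W n. diam_pow s (I n j)))"
      proof (cases "n < m")
        case True
        then show ?thesis by (simp add: V_def diam_pow_def)
      next
        case False
        then have "V (n, j) = I n j" if "j \<in> W n" for j
          using that by (simp add: V_def)
        with False show ?thesis by simp
      qed
      also have "\<dots> \<le> ennreal (if n < m then 0 else c n)"
        using le by simp
      finally show "(\<Sum>j. diam_pow s (V (n, j))) \<le> ennreal (if n < m then 0 else c n)" .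
    qed auto
    also have "\<dots> = ennreal (\<Sum>n. if n < m then 0 else c n)"
    proof (rule suminf_ennreal2)
      show "summable (\<lambda>n. if n < m then 0 else c n)"
        by (rule summable_comparison_test'[OF c(1), of 0]) (use c(2) in auto)
    qed (use c(2) in auto)
    also have "(\<Sum>n. if n < m then 0 else c n) = (\<Sum>n. c (n + m))"
    proof -
      have "summable (\<lambda>n. if n < m then 0 else c n)"
        by (rule summable_comparison_test'[OF c(1), of 0]) (use c(2) in auto)
      from suminf_split_initial_segment[OF this, of m] show ?thesis
        by simp
    qed
    also have "ennreal \<dots> \<le> ennreal \<epsilon>"
      using m2[of m] by (intro ennreal_leI) (simp add: m_def)
    finally show ?thesis .
  qed
  have "hausdorff_pre s \<delta> K \<le> 0" if "\<delta> > 0" for \<delta>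
    by (rule ennreal_le_epsilon) (simp add: that pre_le)
  then have "hausdorff_measure s K \<le> 0"
    unfolding hausdorff_measure_def by (intro SUP_least) simp
  then show ?thesis by simp
qed

lemma hausdorff_dim_less_one:
  assumes "hausdorff_measure s K = 0" "0 \<le> s" "s < 1"
  shows "hausdorff_dim K < 1"
proof -
  have "hausdorff_dim K \<le> ennreal s"
    unfolding hausdorff_dim_def by (rule INF_lower) (use assms in auto)
  also have "\<dots> < 1"
    using assms by (simp add: ennreal_less_one_iff)
  finally show ?thesis .
qed

section \<open>Uniqueness of finite measures on the unit interval\<close>

lemma measure_eqI_unit_interval:
  fixes M N :: "real measure"
  assumes sets: "sets M = sets lborel01" "sets N = sets lborel01"
    and fin: "emeasure M {0..1} < \<infinity>"
    and eq: "\<And>x. 0 \<le> x \<Longrightarrow> x \<le> 1 \<Longrightarrow> emeasure M {0..x} = emeasure N {0..x}"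
  shows "M = N"
proof (rule measure_eqI)
  show "sets M = sets N" using sets by simp
  have sp: "space M = {0..1}" "space N = {0..1}"
    using sets_eq_imp_space_eq[OF sets(1)] sets_eq_imp_space_eq[OF sets(2)]
    by (simp_all add: space_restrict_space)
  have mem: "A \<in> sets M \<longleftrightarrow> A \<in> sets borel \<and> A \<subseteq> {0..1}"
    "A \<in> sets N \<longleftrightarrow> A \<in> sets borel \<and> A \<subseteq> {0..1}" for A
    by (auto simp: sets sets_restrict_space_iff)
  have id_meas: "id \<in> measurable M borel" "id \<in> measurable N borel"
    by (auto simp: measurable_def mem sp)
  have val: "emeasure (distr M borel id) A = emeasure M (A \<inter> {0..1})"
    "emeasure (distr N borel id) A = emeasure N (A \<inter> {0..1})" if "A \<in> sets borel" for A
    using that by (auto simp: emeasure_distr id_meas sp)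
  have finN: "emeasure N {0..1} < \<infinity>" using fin eq[of 1] by simp
  have fin_sub: "emeasure M A < \<infinity>" "emeasure N A < \<infinity>" if "A \<subseteq> {0..1}" for A
  proof -
    have "{0..1} \<in> sets M" "{0..1} \<in> sets N" by (simp_all add: mem)
    then have "emeasure M A \<le> emeasure M {0..1}" "emeasure N A \<le> emeasure N {0..1}"
      using that by (auto intro: emeasure_mono)
    then show "emeasure M A < \<infinity>" "emeasure N A < \<infinity>"
      using fin finN by (auto intro: le_less_trans)
  qed
  \<comment> \<open>Both measures are pushed to the whole line, where agreement on the rays
    \<open>{x<..}\<close> suffices. For \<open>x\<close> in \<open>{0..1}\<close> the ray is the
    complement of \<open>{0..x}\<close> in \<open>{0..1}\<close>, and finiteness allows
    subtraction.\<close>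
  have distr_eq: "distr M borel id = distr N borel id"
  proof (rule measure_eqI_lessThan)
    fix x :: real
    show "emeasure (distr M borel id) {x<..} < \<infinity>"
      using fin_sub(1)[of "{x<..} \<inter> {0..1}"] by (simp add: val)
    consider "x < 0" | "0 \<le> x" "x \<le> 1" | "x > 1" by linarith
    then show "emeasure (distr M borel id) {x<..} = emeasure (distr N borel id) {x<..}"
    proof cases
      case 1
      then have "{x<..} \<inter> {0..1} = {0..1}" by auto
      then show ?thesis using eq[of 1] by (simp add: val)
    next
      case 2
      then have *: "{x<..} \<inter> {0..1} = {0..1} - {0..x}" by auto
      have "emeasure M ({0..1} - {0..x}) = emeasure M {0..1} - emeasure M {0..x}"
        "emeasure N ({0..1} - {0..x}) = emeasure N {0..1} - emeasure N {0..x}"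
        using 2 fin_sub[of "{0..x}"] by (auto intro!: emeasure_Diff simp: mem)
      then show ?thesis using 2 eq[of 1] eq[of x] by (simp add: val *)
    next
      case 3
      then have "{x<..} \<inter> {0..1} = {}" by auto
      then show ?thesis by (simp add: val)
    qed
  qed auto
  fix A assume "A \<in> sets M"
  then have "A \<in> sets borel" "A \<inter> {0..1} = A" by (auto simp: mem)
  then show "emeasure M A = emeasure N A"
    using val[of A] distr_eq by simp
qed

section \<open>Moebius maps of the unit interval fixing both endpoints\<close>

text \<open>In the odds coordinate \<open>z / (1 - z)\<close> this is multiplication by
  \<open>u\<close>. The derivative is \<open>u\<close> at 0 and \<open>1 / u\<close> at 1.\<close>

definition mob :: "real \<Rightarrow> real \<Rightarrow> real" where
  "mob u z = u * z / (1 - z + u * z)"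

lemma convex_comb_pos: "0 < 1 - z + u * z" if "0 < u" "0 \<le> z" "z \<le> (1::real)"
proof (cases "z = 1")
  case False
  then show ?thesis using that by (intro add_pos_nonneg) auto
qed (use that in auto)

lemma mob_simps [simp]: "mob u 0 = 0" "u \<noteq> 0 \<Longrightarrow> mob u 1 = 1" "mob 1 z = z"
  by (auto simp: mob_def)

lemma mob_diff:
  assumes "0 < u" "0 \<le> x" "x \<le> 1" "0 \<le> y" "y \<le> 1"
  shows "mob u x - mob u y = u * (x - y) / ((1 - x + u * x) * (1 - y + u * y))"
  using convex_comb_pos[of u x] convex_comb_pos[of u y] assms
  unfolding mob_def by (simp add: divide_simps) (simp add: algebra_simps)

lemma mob_strict_mono: "mob u x < mob u y" if "0 < u" "0 \<le> x" "x < y" "y \<le> 1"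
proof -
  have "0 < u * (y - x) / ((1 - y + u * y) * (1 - x + u * x))"
    using that by (intro divide_pos_pos mult_pos_pos convex_comb_pos) auto
  also have "\<dots> = mob u y - mob u x"
    using that by (intro mob_diff[symmetric]) auto
  finally show ?thesis by simp
qed

lemma mob_mono: "mob u x \<le> mob u y" if "0 < u" "0 \<le> x" "x \<le> y" "y \<le> 1"
  using mob_strict_mono[of u x y] that by (cases "x = y") auto

lemma mob_range: "0 \<le> mob u x" "mob u x \<le> 1" if "0 < u" "0 \<le> x" "x \<le> 1"
  using mob_mono[of u 0 x] mob_mono[of u x 1] that by auto

lemma mob_continuous: "0 < u \<Longrightarrow> continuous_on {0..1} (mob u)"
  unfolding mob_def[abs_def]
  by (intro continuous_intros) (use convex_comb_pos in \<open>fastforce\<close>)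

text \<open>The denominators are convex combinations of 1 and \<open>u\<close>, hence at least
  \<open>min 1 u\<close>. The resulting Lipschitz constant is the larger of the endpoint derivatives
  \<open>u\<close> and \<open>1 / u\<close>.\<close>

lemma mob_dist_le:
  assumes "0 < u" "0 \<le> x" "x \<le> 1" "0 \<le> y" "y \<le> 1"
  shows "\<bar>mob u x - mob u y\<bar> \<le> u / (min 1 u)\<^sup>2 * \<bar>x - y\<bar>"
proof -
  have lower: "min 1 u \<le> 1 - z + u * z" if "0 \<le> z" "z \<le> 1" for z
  proof -
    have "min 1 u * (1 - z) + min 1 u * z \<le> 1 * (1 - z) + u * z"
      using that by (intro add_mono mult_right_mono) auto
    then show ?thesis by (simp add: algebra_simps)
  qed
  have pos: "0 < 1 - x + u * x" "0 < 1 - y + u * y"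
    using assms by (auto intro!: convex_comb_pos)
  have "\<bar>mob u x - mob u y\<bar> = u * \<bar>x - y\<bar> / ((1 - x + u * x) * (1 - y + u * y))"
    using assms pos by (simp add: mob_diff abs_mult)
  also have "\<dots> \<le> u * \<bar>x - y\<bar> / (min 1 u)\<^sup>2"
    unfolding power2_eq_square using assms lower[of x] lower[of y]
    by (intro divide_left_mono mult_mono) (auto intro!: mult_pos_pos pos)
  finally show ?thesis by simp
qed

lemma one_minus_mob:
  assumes "0 < u" "0 \<le> z" "z \<le> 1"
  shows "1 - mob u z = (1 - z) / (1 - z + u * z)"
  using convex_comb_pos[OF assms] by (simp add: mob_def divide_simps)

text \<open>After division by \<open>mob u t\<close> the left side is a Moebius map fixing 0 and 1,
  so it is some \<open>mob v\<close>, and its derivative at 0 gives \<open>v\<close>.\<close>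

lemma mob_scaled_mob:
  assumes "0 < u" "0 < k" "0 < t" "t < 1" "0 \<le> z" "z \<le> 1"
  shows "mob u (t * mob k z) = mob u t * mob (k * (1 - t + u * t)) z"
proof -
  define D where "D = 1 - t + u * t"
  define e where "e = 1 - z + k * z"
  have pos: "0 < D" "0 < e" "0 < 1 - z + k * D * z"
    using assms convex_comb_pos[of u t] convex_comb_pos[of k z] convex_comb_pos[of "k * D" z]
    by (auto simp: D_def e_def)
  have "1 - t * mob k z + u * (t * mob k z) = (1 - z + k * D * z) / e"
    using pos by (simp add: mob_def e_def[symmetric] divide_simps)
      (simp add: D_def e_def algebra_simps)
  moreover have "u * (t * mob k z) = u * t * k * z / e"
    by (simp add: mob_def e_def)
  ultimately have "mob u (t * mob k z) = u * t * k * z / (1 - z + k * D * z)"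
    unfolding mob_def[of u] using pos by simp
  also have "\<dots> = u * t / D * (k * D * z / (1 - z + k * D * z))"
    using pos by simp
  finally show ?thesis by (simp add: mob_def D_def)
qed

text \<open>The counterpart on \<open>[t, 1]\<close>: subtracting \<open>mob u t\<close> and
  dividing by \<open>1 - mob u t\<close> again leaves a Moebius map fixing 0 and 1.\<close>

lemma mob_shifted_mob:
  assumes "0 < u" "0 < k" "0 < t" "t < 1" "0 \<le> z" "z \<le> 1"
  shows "mob u (t + (1 - t) * mob k z) = mob u t + (1 - mob u t) * mob (k * u / (1 - t + u * t)) z"
proof -
  define D where "D = 1 - t + u * t"
  define e where "e = 1 - z + k * z"
  define v where "v = k * u / D"
  define w where "w = t + (1 - t) * mob k z"
  have pos: "0 < D" "0 < e" "0 < v"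
    using assms convex_comb_pos[of u t] convex_comb_pos[of k z]
    by (auto simp: D_def e_def v_def)
  have q: "0 < 1 - z + v * z"
    using pos assms by (intro convex_comb_pos)
  have w01: "0 \<le> w" "w \<le> 1"
  proof -
    show "0 \<le> w" using mob_range[of k z] assms by (simp add: w_def)
    have "(1 - t) * mob k z \<le> (1 - t) * 1"
      using mob_range[of k z] assms by (intro mult_left_mono) auto
    then show "w \<le> 1" by (simp add: w_def)
  qed
  \<comment> \<open>Passing to complements removes the additive shift, and
    \<open>1 - mob u w\<close> then factors as required.\<close>
  have "1 - w = (1 - t) * (1 - mob k z)" by (simp add: w_def algebra_simps)
  then have w1: "1 - w = (1 - t) * (1 - z) / e"
    using assms by (simp add: one_minus_mob e_def)
  have w2: "1 - w + u * w = D * (1 - z + v * z) / e"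
  proof -
    have "e * mob k z = k * z"
      using pos by (simp add: mob_def e_def)
    moreover have "e * w = t * e + (1 - t) * (e * mob k z)"
      by (simp add: w_def algebra_simps)
    ultimately have "e * w = t * e + (1 - t) * (k * z)" by simp
    moreover have "e * (1 - w) = (1 - t) * (1 - z)"
      using w1 pos by simp
    moreover have "e * (1 - w + u * w) = e * (1 - w) + u * (e * w)"
      by (simp add: algebra_simps)
    ultimately have "e * (1 - w + u * w) = (1 - t) * (1 - z) + u * (t * e + (1 - t) * (k * z))"
      by simp
    also have "\<dots> = D * (1 - z) + k * u * z"
      by (simp add: D_def e_def algebra_simps)
    also have "\<dots> = D * (1 - z + v * z)"
      using pos by (simp add: v_def field_simps)
    finally show ?thesis using pos by (simp add: field_simps)
  qed
  have "1 - mob u w = (1 - w) / (1 - w + u * w)"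
    using assms w01 by (intro one_minus_mob)
  also have "\<dots> = ((1 - t) * (1 - z) / e) / (D * (1 - z + v * z) / e)"
    by (simp only: w2) (simp only: w1)
  also have "\<dots> = (1 - t) * (1 - z) / (D * (1 - z + v * z))"
    using pos by simp
  also have "\<dots> = (1 - mob u t) * (1 - mob v z)"
    using assms pos by (simp add: one_minus_mob D_def[symmetric])
  finally show ?thesis by (simp add: w_def v_def D_def algebra_simps)
qed


section \<open>A dimension bound from Hellinger sums\<close>

lemma emeasure_mu_of_interval:
  assumes "continuous_on {0..1} f" "mono_on {0..1} f" "f 0 = 0" "f 1 = 1"
    and "0 \<le> x" "x \<le> y" "y \<le> 1"
  shows "emeasure (mu_of f) {x..y} = ennreal (f y - f x)"
proof -
  define F where "F = (\<lambda>x. if x < 0 then 0 else if x \<le> 1 then f x else 1)"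
  have F_eq: "F y = f (min 1 (max 0 y))" for y
    using assms(3,4) by (auto simp: F_def)
  have mono: "F y \<le> F z" if "y \<le> z" for y z
    unfolding F_eq using that by (intro mono_onD[OF assms(2)]) auto
  have "continuous_on UNIV (\<lambda>y. f (min 1 (max 0 y)))"
    by (rule continuous_on_compose2[OF assms(1)]) (auto intro!: continuous_intros)
  then have cont: "continuous_on UNIV F"
    unfolding F_eq[abs_def] .
  have "emeasure (mu_of f) {x..y} = emeasure (interval_measure F) {x..y}"
    unfolding mu_of_def F_def[symmetric] using assms
    by (intro emeasure_restrict_space) auto
  also have "\<dots> = ennreal (F y - F x)"
    using assms mono cont by (intro emeasure_interval_measure_Icc) auto
  finally show ?thesis
    using assms by (simp add: F_def)
qed

lemma space_mu_of [simp]: "space (mu_of f) = {0..1}"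
  by (simp add: mu_of_def space_restrict_space)

lemma mem_sets_mu_of: "A \<in> sets (mu_of f) \<longleftrightarrow> A \<in> sets borel \<and> A \<subseteq> {0..1}"
  by (auto simp: mu_of_def sets_restrict_space_iff)

lemma unit_interval_grid_cover:
  assumes "0 \<le> x" "x \<le> 1" "0 < N"
  obtains j where "j < N" "real j / real N \<le> x" "x \<le> (real j + 1) / real N"
proof (cases "x = 1")
  \<comment> \<open>At the right endpoint the floor would give the index \<open>N\<close>, which is
    out of range.\<close>
  case True
  then show ?thesis using assms by (intro that[of "N - 1"]) (auto simp: of_nat_diff)
next
  case False
  define j where "j = nat \<lfloor>x * N\<rfloor>"
  have j: "real j \<le> x * N" "x * N \<le> real j + 1"
    using assms unfolding j_def by (auto simp: of_nat_nat)
  have "x * N < N" using False assms by simp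
  then have "j < N" using j(1) by linarith
  then show ?thesis using j assms by (intro that[of j]) (auto simp: field_simps)
qed

text \<open>At level \<open>n\<close> the intervals are split into heavy and light ones, and
  \<open>K\<close> collects the points lying in heavy intervals infinitely often. Borel-Cantelli
  applies twice: the light mass is summable, so \<open>K\<close> has full mass; the heavy intervals,
  at most \<open>(4 * L)^n\<close> of length \<open>4^(-n)\<close>, have summable total length, so
  \<open>K\<close> is Lebesgue null. The same covers bound the dimension.\<close>

lemma hellinger_sum_imp_small_dim:
  fixes f :: "real \<Rightarrow> real"
  assumes f: "continuous_on {0..1} f" "mono_on {0..1} f" "f 0 = 0" "f 1 = 1"
    and L0: "0 < L0" "L0 < 1"
    and sum_le: "\<And>n. (\<Sum>j<4^n. sqrt (f ((real j + 1) / 4^n) - f (real j / 4^n))) \<le> (2 * L0)^n"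
  obtains K where "K \<in> sets (mu_of f)" "emeasure (mu_of f) K = 1" "hausdorff_dim K < 1"
    "emeasure lborel K = 0"
proof -
  \<comment> \<open>Raising the rate to at least 1/4 keeps \<open>4 * sqrt L\<close> above 1, which
    makes the Hausdorff exponent \<open>s\<close> chosen below positive.\<close>
  define L where "L = max L0 (1/4)"
  have L: "1/4 \<le> L" "0 < L" "L < 1" using L0 by (auto simp: L_def)
  define m where "m n j = f ((real j + 1) / 4^n) - f (real j / 4^n)" for n :: nat and j :: nat
  define I where "I n j = {real j / 4^n .. (real j + 1) / 4^n}" for n :: nat and j :: nat
  \<comment> \<open>The threshold makes both the number of heavy intervals times \<open>4\<^sup>-\<^sup>n\<close> and the mass of the light
    ones exponentially small.\<close>
  define W where "W n = {j. j < 4^n \<and> 1 / (4 * L)^n \<le> m n j}" for n :: nat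
  define Bad where "Bad n = {j. j < 4^n \<and> m n j < 1 / (4 * L)^n}" for n :: nat
  define B where "B n = (\<Union>j\<in>W n. I n j)" for n
  define K where "K = limsup B"
  have [simp]: "finite (W n)" "finite (Bad n)" for n
    by (auto simp: W_def Bad_def)
  have sub: "W n \<subseteq> {..<4^n}" "Bad n \<subseteq> {..<4^n}" for n
    by (auto simp: W_def Bad_def)
  have grid: "0 \<le> real j / 4^n" "real j / 4^n \<le> (real j + 1) / 4^n" "(real j + 1) / 4^n \<le> 1"
    if "j < 4^n" for n j
  proof -
    have "real (Suc j) \<le> real (4^n)" using that by (intro of_nat_mono) simp
    then show "(real j + 1) / 4^n \<le> 1" by simp
  qed (auto simp: divide_right_mono)
  have m_nonneg: "0 \<le> m n j" if "j < 4^n" for n j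
  proof -
    have "f (real j / 4^n) \<le> f ((real j + 1) / 4^n)"
      by (rule mono_onD[OF f(2)])
        (use grid[OF that] in \<open>auto simp del: divide_le_eq_1 divide_le_eq_1_pos intro: order_trans\<close>)
    then show ?thesis by (simp add: m_def)
  qed
  have m_sum: "(\<Sum>j<4^n. m n j) = 1" for n
    using sum_lessThan_telescope[of "\<lambda>j. f (real j / 4^n)" "4^n"] f
    by (simp add: m_def add.commute)
  have hell: "(\<Sum>j<4^n. sqrt (m n j)) \<le> (2 * L)^n" for n
  proof -
    have "(2 * L0)^n \<le> (2 * L)^n"
      using L0 by (intro power_mono) (auto simp: L_def)
    with sum_le[of n] show ?thesis unfolding m_def by linarith
  qed
  have I_sub: "I n j \<subseteq> {0..1}" if "j < 4^n" for n j
    using grid[OF that] by (auto simp: I_def)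
  have card_W: "real (card (W n)) \<le> (4 * L)^n" for n
  proof -
    have "real (card (W n)) * (1 / (4 * L)^n) \<le> (\<Sum>j\<in>W n. m n j)"
      by (rule sum_bounded_below) (simp add: W_def)
    also have "\<dots> \<le> (\<Sum>j<4^n. m n j)"
      by (rule sum_mono2) (use sub m_nonneg in auto)
    finally show ?thesis using L by (simp add: m_sum field_simps)
  qed
  have bad_sum: "(\<Sum>j\<in>Bad n. m n j) \<le> sqrt L ^ n" for n
  proof -
    \<comment> \<open>On a light interval one factor of \<open>m = sqrt m * sqrt m\<close> is
      bounded by the root of the threshold. The other factor is summed by the Hellinger
      bound.\<close>
    have "(\<Sum>j\<in>Bad n. m n j) \<le> (\<Sum>j\<in>Bad n. (1 / (2 * sqrt L))^n * sqrt (m n j))"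
    proof (rule sum_mono)
      fix j assume j: "j \<in> Bad n"
      have "sqrt (m n j) \<le> sqrt ((1 / (4 * L))^n)"
        using j by (simp add: Bad_def power_divide)
      also have "\<dots> = (1 / (2 * sqrt L))^n"
        using L by (simp add: real_sqrt_power real_sqrt_divide real_sqrt_mult)
      finally have "sqrt (m n j) * sqrt (m n j) \<le> (1 / (2 * sqrt L))^n * sqrt (m n j)"
        using m_nonneg[of j n] j by (intro mult_right_mono) (auto simp: Bad_def)
      then show "m n j \<le> (1 / (2 * sqrt L))^n * sqrt (m n j)"
        using m_nonneg[of j n] j by (auto simp: Bad_def)
    qed
    also have "\<dots> = (1 / (2 * sqrt L))^n * (\<Sum>j\<in>Bad n. sqrt (m n j))"
      by (simp add: sum_distrib_left)
    also have "\<dots> \<le> (1 / (2 * sqrt L))^n * (\<Sum>j<4^n. sqrt (m n j))"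
      using L by (intro mult_left_mono sum_mono2) (use sub m_nonneg in auto)
    also have "\<dots> \<le> (1 / (2 * sqrt L))^n * (2 * L)^n"
      using L by (intro mult_left_mono hell) auto
    also have "\<dots> = (1 / (2 * sqrt L) * (2 * L))^n"
      by (rule power_mult_distrib[symmetric])
    also have "1 / (2 * sqrt L) * (2 * L) = sqrt L"
      using L by (simp add: real_div_sqrt)
    finally show ?thesis .
  qed
  have B_sets: "B n \<in> sets borel" "B n \<subseteq> {0..1}" for n
  proof -
    show "B n \<in> sets borel" unfolding B_def I_def by (intro sets.finite_UN) auto
    show "B n \<subseteq> {0..1}" unfolding B_def
    proof (rule UN_least)
      fix j assume "j \<in> W n"
      then show "I n j \<subseteq> {0..1}" using sub by (intro I_sub) auto
    qed
  qed
  have K_sets: "K \<in> sets borel" "K \<subseteq> {0..1}"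
  proof -
    show "K \<in> sets borel" unfolding K_def using B_sets(1) by measurable
    show "K \<subseteq> {0..1}" using B_sets(2) unfolding K_def subset_iff mem_limsup_iff by blast
  qed
  then have K_mu: "K \<in> sets (mu_of f)" by (simp add: mem_sets_mu_of)
  have mu_space: "emeasure (mu_of f) {0..1} = 1"
    using emeasure_mu_of_interval[OF f, of 0 1] f by simp
  have "{0..1} - K \<in> null_sets (mu_of f)"
  proof -
    have A_sets: "{0..1} - B n \<in> sets (mu_of f)" for n
      using B_sets by (auto simp: mem_sets_mu_of)
    have A_le: "emeasure (mu_of f) ({0..1} - B n) \<le> ennreal (sqrt L ^ n)" for n
    proof -
      have I_Bad: "I n j \<in> sets (mu_of f)" if "j \<in> Bad n" for j
        using I_sub[of j n] that by (simp add: mem_sets_mu_of I_def Bad_def)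
      have "{0..1} - B n \<subseteq> (\<Union>j\<in>Bad n. I n j)"
      proof
        fix x assume x: "x \<in> {0..1} - B n"
        then obtain j where j: "j < 4^n" "x \<in> I n j"
          using unit_interval_grid_cover[of x "4^n"] by (auto simp: I_def)
        with x have "j \<notin> W n" by (auto simp: B_def)
        with j have "j \<in> Bad n" by (simp add: W_def Bad_def not_le)
        then show "x \<in> (\<Union>j\<in>Bad n. I n j)" using j by blast
      qed
      then have "emeasure (mu_of f) ({0..1} - B n) \<le> emeasure (mu_of f) (\<Union>j\<in>Bad n. I n j)"
        using I_Bad by (intro emeasure_mono sets.finite_UN) auto
      also have "\<dots> \<le> (\<Sum>j\<in>Bad n. emeasure (mu_of f) (I n j))"
        using I_Bad by (intro emeasure_subadditive_finite) auto
      also have "\<dots> = (\<Sum>j\<in>Bad n. ennreal (m n j))"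
      proof (rule sum.cong[OF refl])
        fix j assume "j \<in> Bad n"
        then have "j < 4^n" by (simp add: Bad_def)
        from emeasure_mu_of_interval[OF f grid[OF this]]
        show "emeasure (mu_of f) (I n j) = ennreal (m n j)"
          by (simp add: I_def m_def)
      qed
      also have "\<dots> = ennreal (\<Sum>j\<in>Bad n. m n j)"
        by (intro sum_ennreal m_nonneg) (simp add: Bad_def)
      also have "\<dots> \<le> ennreal (sqrt L ^ n)"
        by (intro ennreal_leI bad_sum)
      finally show ?thesis .
    qed
    have "limsup (\<lambda>n. {0..1} - B n) \<in> null_sets (mu_of f)"
    proof (rule borel_cantelli_limsup1)
      show "{0..1} - B n \<in> sets (mu_of f)" for n by (rule A_sets)
      show "emeasure (mu_of f) ({0..1} - B n) < \<infinity>" for n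
        using le_less_trans[OF A_le] by simp
      show "summable (\<lambda>n. measure (mu_of f) ({0..1} - B n))"
      proof (rule summable_comparison_test')
        show "summable (\<lambda>n. sqrt L ^ n)" using L by (intro summable_geometric) auto
        show "norm (measure (mu_of f) ({0..1} - B n)) \<le> sqrt L ^ n" for n
          using A_le[of n] L by (simp add: measure_def enn2real_leI)
      qed
    qed
    \<comment> \<open>A point outside \<open>K\<close> lies in only finitely many
      \<open>B n\<close>, hence in all later complements, and so in their limsup.\<close>
    moreover have "{0..1} - K \<subseteq> limsup (\<lambda>n. {0..1} - B n)"
    proof
      fix x assume x: "x \<in> {0..1} - K"
      then obtain n where n: "\<And>k. k \<ge> n \<Longrightarrow> x \<notin> B k"
        unfolding K_def Diff_iff mem_limsup_iff by blast
      have "\<exists>k\<ge>i. x \<in> {0..1} - B k" for i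
        using x n[of "max i n"] by (intro exI[of _ "max i n"]) auto
      then show "x \<in> limsup (\<lambda>n. {0..1} - B n)"
        unfolding mem_limsup_iff by blast
    qed
    ultimately show ?thesis
      using K_mu by (elim null_sets_subset) (auto simp: mem_sets_mu_of)
  qed
  then have "emeasure (mu_of f) ({0..1} - ({0..1} - K)) = 1"
    using mu_space by (subst emeasure_Diff_null_set) (auto simp: mem_sets_mu_of)
  then have mu_K: "emeasure (mu_of f) K = 1"
    using K_sets by (simp add: double_diff)
  have "K \<in> null_sets lborel"
    unfolding K_def
  proof (rule borel_cantelli_limsup1)
    have le: "emeasure lborel (B n) \<le> ennreal (L ^ n)" for n
    proof -
      have "emeasure lborel (B n) \<le> (\<Sum>j\<in>W n. emeasure lborel (I n j))"
        unfolding B_def by (intro emeasure_subadditive_finite) (auto simp: I_def)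
      also have "\<dots> = (\<Sum>j\<in>W n. ennreal (1 / 4^n))"
        by (intro sum.cong refl) (simp add: I_def divide_right_mono add_divide_distrib)
      also have "\<dots> = ennreal (\<Sum>j\<in>W n. 1 / 4^n)"
        by (intro sum_ennreal) auto
      also have "\<dots> \<le> ennreal (L ^ n)"
        using card_W[of n] by (intro ennreal_leI) (simp add: field_simps power_mult_distrib)
      finally show ?thesis .
    qed
    show "B n \<in> sets lborel" for n using B_sets by simp
    show "emeasure lborel (B n) < \<infinity>" for n
      using le_less_trans[OF le] by simp
    show "summable (\<lambda>n. measure lborel (B n))"
    proof (rule summable_comparison_test')
      show "summable (\<lambda>n. L ^ n)" using L by (intro summable_geometric) auto
      show "norm (measure lborel (B n)) \<le> L ^ n" for n
        using le[of n] L by (simp add: measure_def enn2real_leI)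
    qed
  qed
  then have leb_K: "emeasure lborel K = 0" by auto
  \<comment> \<open>Chosen so that \<open>(4 L)\<^sup>n\<close> intervals of length \<open>4\<^sup>-\<^sup>n\<close> contribute \<open>(sqrt L)\<^sup>n\<close>.\<close>
  define s where "s = log 4 (4 * sqrt L)"
  have sqrt_L: "1/2 \<le> sqrt L" "sqrt L < 1"
    using L real_sqrt_le_mono[of "1/4" L] by (auto simp: real_sqrt_divide)
  have s: "0 < s" "s < 1"
    using sqrt_L L unfolding s_def by (simp_all add: zero_less_log_cancel_iff log_less_one_cancel_iff)
  have four_s: "4 powr s = 4 * sqrt L"
    using L by (simp add: s_def)
  have "hausdorff_measure s K = 0"
  proof (rule hausdorff_measure_limsup_eq_0)
    show "K \<subseteq> limsup (\<lambda>n. \<Union>j\<in>W n. I n j)"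
      by (simp add: K_def B_def[abs_def])
    show "bounded (I n j)" for n j by (simp add: I_def)
    have diam: "diameter (I n j) = (1/4)^n" for n j
      by (simp add: I_def divide_right_mono not_less add_divide_distrib power_divide)
    then show "diameter (I n j) \<le> (1/4)^n" for n j by simp
    show "(\<lambda>n. (1/4::real)^n) \<longlonglongrightarrow> 0" by (intro LIMSEQ_power_zero) auto
    show "summable (\<lambda>n. sqrt L ^ n)" using L by (intro summable_geometric) auto
    show "0 \<le> sqrt L ^ n" for n using L by simp
    have dp: "diam_pow s (I n j) = ennreal ((1 / (4 * sqrt L))^n)" for n j
    proof -
      have "I n j \<noteq> {}" by (auto simp: I_def divide_right_mono)
      moreover have "((1/4::real)^n) powr s = ((1/4) powr s)^n"
      proof -
        have "((1/4::real)^n) powr s = ((1/4) powr real n) powr s"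
          by (subst powr_realpow) auto
        also have "\<dots> = ((1/4) powr s)^n"
          by (subst powr_power) (auto simp: powr_powr mult.commute)
        finally show ?thesis .
      qed
      moreover have "(1/4::real) powr s = 1 / (4 * sqrt L)"
        by (simp add: powr_divide four_s)
      ultimately show ?thesis using s by (simp add: diam_pow_def diam)
    qed
    show "(\<Sum>j\<in>W n. diam_pow s (I n j)) \<le> ennreal (sqrt L ^ n)" for n
    proof -
      have "(\<Sum>j\<in>W n. diam_pow s (I n j)) = (\<Sum>j\<in>W n. ennreal ((1 / (4 * sqrt L))^n))"
        unfolding dp ..
      also have "\<dots> = ennreal (\<Sum>j\<in>W n. (1 / (4 * sqrt L))^n)"
        using L by (intro sum_ennreal) auto
      also have "(\<Sum>j\<in>W n. (1 / (4 * sqrt L))^n) \<le> (4 * L)^n * (1 / (4 * sqrt L))^n"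
        using L card_W[of n] by (simp only: sum_constant) (intro mult_right_mono, auto)
      also have "\<dots> = (4 * L * (1 / (4 * sqrt L)))^n"
        by (rule power_mult_distrib[symmetric])
      also have "4 * L * (1 / (4 * sqrt L)) = sqrt L"
        using L by (simp add: real_div_sqrt)
      finally show ?thesis by (simp add: ennreal_leI)
    qed
  qed simp
  then have "hausdorff_dim K < 1"
    using s by (intro hausdorff_dim_less_one) auto
  then show ?thesis by (rule that[OF K_mu mu_K _ leb_K])
qed


section \<open>Moebius systems on the unit interval\<close>

lemma le_mult_less_one_imp_zero: "M = 0" if "M \<le> q * M" "q < 1" "0 \<le> M" for M q :: real
proof -
  have "(1 - q) * M \<le> 0" using that(1) by (simp add: algebra_simps)
  then show ?thesis using that by (simp add: mult_le_0_iff)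
qed

lemma sum_lessThan_add: "(\<Sum>j<m + k. h j) = (\<Sum>j<m. h j) + (\<Sum>j<k. h (m + j))"
  for h :: "nat \<Rightarrow> real"
  by (induction k) (simp_all add: add.assoc)

text \<open>By the parallelogram law the squares of the sum and of the difference of the two roots
  add up to 2, so equality forces the roots to coincide.\<close>

lemma sqrt_sum_le:
  assumes "0 \<le> p" "p \<le> 1"
  shows "sqrt p + sqrt (1 - p) \<le> sqrt 2" "sqrt p + sqrt (1 - p) = sqrt 2 \<Longrightarrow> p = 1/2"
proof -
  have "(sqrt p + sqrt (1 - p))\<^sup>2 + (sqrt p - sqrt (1 - p))\<^sup>2 = 2 * (sqrt p)\<^sup>2 + 2 * (sqrt (1 - p))\<^sup>2"
    by (simp add: power2_eq_square algebra_simps)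
  then have id: "(sqrt p + sqrt (1 - p))\<^sup>2 + (sqrt p - sqrt (1 - p))\<^sup>2 = 2"
    using assms by simp
  then have "(sqrt p + sqrt (1 - p))\<^sup>2 \<le> 2"
    using zero_le_power2[of "sqrt p - sqrt (1 - p)"] by linarith
  then show "sqrt p + sqrt (1 - p) \<le> sqrt 2" by (rule real_le_rsqrt)
  assume "sqrt p + sqrt (1 - p) = sqrt 2"
  with id have "(sqrt p - sqrt (1 - p))\<^sup>2 = 0" by simp
  then have "sqrt p = sqrt (1 - p)" by simp
  then show "p = 1/2" by simp
qed

section \<open>The normal form of a de Rham system and its contraction property\<close>

text \<open>The inequalities say that the endpoint derivatives \<open>t * k0\<close>,
  \<open>t / k0\<close> of the first map and \<open>(1 - t) * k1\<close>,
  \<open>(1 - t) / k1\<close> of the second are less than 1.\<close>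

locale mob_system =
  fixes t k0 k1 :: real
  assumes t: "0 < t" "t < 1"
    and k0: "t < k0" "t * k0 < 1"
    and k1: "1 - t < k1" "(1 - t) * k1 < 1"
begin

lemma k_pos: "0 < k0" "0 < k1"
  using t k0 k1 by auto

definition solution :: "(real \<Rightarrow> real) \<Rightarrow> bool" where
  "solution g \<longleftrightarrow> g ` {0..1} \<subseteq> {0..1} \<and> continuous_on {0..1} g \<and>
     (\<forall>x. 0 \<le> x \<and> x \<le> 1/2 \<longrightarrow> g x = t * mob k0 (g (2 * x))) \<and>
     (\<forall>x. 1/2 \<le> x \<and> x \<le> 1 \<longrightarrow> g x = t + (1 - t) * mob k1 (g (2 * x - 1)))"

lemma solutionD:
  assumes "solution g"
  shows "\<lbrakk>0 \<le> x; x \<le> 1\<rbrakk> \<Longrightarrow> 0 \<le> g x" "\<lbrakk>0 \<le> x; x \<le> 1\<rbrakk> \<Longrightarrow> g x \<le> 1"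
    "continuous_on {0..1} g"
    "\<lbrakk>0 \<le> x; x \<le> 1/2\<rbrakk> \<Longrightarrow> g x = t * mob k0 (g (2 * x))"
    "\<lbrakk>1/2 \<le> x; x \<le> 1\<rbrakk> \<Longrightarrow> g x = t + (1 - t) * mob k1 (g (2 * x - 1))"
  using assms by (auto simp: solution_def image_subset_iff)

lemma contraction:
  obtains q where "0 \<le> q" "q < 1"
    "\<And>x y. \<lbrakk>0 \<le> x; x \<le> 1; 0 \<le> y; y \<le> 1\<rbrakk> \<Longrightarrow> \<bar>t * mob k0 x - t * mob k0 y\<bar> \<le> q * \<bar>x - y\<bar>"
    "\<And>x y. \<lbrakk>0 \<le> x; x \<le> 1; 0 \<le> y; y \<le> 1\<rbrakk> \<Longrightarrow>
      \<bar>(1 - t) * mob k1 x - (1 - t) * mob k1 y\<bar> \<le> q * \<bar>x - y\<bar>"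
proof -
  \<comment> \<open>The quotient \<open>k / (min 1 k)\<^sup>2\<close> is \<open>1 / k\<close> or
    \<open>k\<close>, according to whether \<open>k\<close> is at most 1, so each case uses one of
    the two derivative bounds.\<close>
  have factor: "0 \<le> r * (k / (min 1 k)\<^sup>2) \<and> r * (k / (min 1 k)\<^sup>2) < 1"
    if "0 < r" "r < k" "r * k < 1" for r k :: real
    using that by (cases "k \<le> 1") (auto simp: power2_eq_square)
  define q0 where "q0 = t * (k0 / (min 1 k0)\<^sup>2)"
  define q1 where "q1 = (1 - t) * (k1 / (min 1 k1)\<^sup>2)"
  have q: "0 \<le> q0" "q0 < 1" "0 \<le> q1" "q1 < 1"
    using factor[of t k0] factor[of "1 - t" k1] t k0 k1 by (auto simp: q0_def q1_def)
  show thesis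
  proof
    show "0 \<le> max q0 q1" "max q0 q1 < 1" using q by auto
  next
    fix x y :: real assume xy: "0 \<le> x" "x \<le> 1" "0 \<le> y" "y \<le> 1"
    have "\<bar>t * mob k0 x - t * mob k0 y\<bar> = t * \<bar>mob k0 x - mob k0 y\<bar>"
      using t by (simp add: abs_mult right_diff_distrib[symmetric])
    also have "\<dots> \<le> t * (k0 / (min 1 k0)\<^sup>2 * \<bar>x - y\<bar>)"
      using t k_pos xy by (intro mult_left_mono mob_dist_le) auto
    also have "\<dots> = q0 * \<bar>x - y\<bar>" by (simp add: q0_def)
    also have "\<dots> \<le> max q0 q1 * \<bar>x - y\<bar>" by (intro mult_right_mono) auto
    finally show "\<bar>t * mob k0 x - t * mob k0 y\<bar> \<le> max q0 q1 * \<bar>x - y\<bar>" .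
    have "\<bar>(1 - t) * mob k1 x - (1 - t) * mob k1 y\<bar> = (1 - t) * \<bar>mob k1 x - mob k1 y\<bar>"
      using t by (simp add: abs_mult right_diff_distrib[symmetric])
    also have "\<dots> \<le> (1 - t) * (k1 / (min 1 k1)\<^sup>2 * \<bar>x - y\<bar>)"
      using t k_pos xy by (intro mult_left_mono mob_dist_le) auto
    also have "\<dots> = q1 * \<bar>x - y\<bar>" by (simp add: q1_def)
    also have "\<dots> \<le> max q0 q1 * \<bar>x - y\<bar>" by (intro mult_right_mono) auto
    finally show "\<bar>(1 - t) * mob k1 x - (1 - t) * mob k1 y\<bar> \<le> max q0 q1 * \<bar>x - y\<bar>" .
  qed
qed

text \<open>The distance of two solutions attains its maximum on the compact interval. There the
  functional equation bounds it by \<open>q < 1\<close> times the distance at another point, so the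
  maximum is 0.\<close>

lemma solution_unique:
  assumes f: "solution f" and g: "solution g" and x: "0 \<le> x" "x \<le> 1"
  shows "f x = g x"
proof -
  obtain q where q: "0 \<le> q" "q < 1"
    and q0: "\<And>x y. \<lbrakk>0 \<le> x; x \<le> 1; 0 \<le> y; y \<le> 1\<rbrakk> \<Longrightarrow> \<bar>t * mob k0 x - t * mob k0 y\<bar> \<le> q * \<bar>x - y\<bar>"
    and q1: "\<And>x y. \<lbrakk>0 \<le> x; x \<le> 1; 0 \<le> y; y \<le> 1\<rbrakk> \<Longrightarrow>
      \<bar>(1 - t) * mob k1 x - (1 - t) * mob k1 y\<bar> \<le> q * \<bar>x - y\<bar>"
    using contraction by blast
  note f = solutionD[OF f] and g = solutionD[OF g]
  have "continuous_on {0..1} (\<lambda>x. \<bar>f x - g x\<bar>)"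
    by (intro continuous_intros f(3) g(3))
  then obtain z where z: "z \<in> {0..1}" and max: "\<And>y. y \<in> {0..1} \<Longrightarrow> \<bar>f y - g y\<bar> \<le> \<bar>f z - g z\<bar>"
    using continuous_attains_sup[of "{0..1::real}" "\<lambda>x. \<bar>f x - g x\<bar>"] by auto
  have "\<bar>f z - g z\<bar> \<le> q * \<bar>f z - g z\<bar>"
  proof (cases "z \<le> 1/2")
    case True
    have "\<bar>f z - g z\<bar> \<le> q * \<bar>f (2 * z) - g (2 * z)\<bar>"
      using True z f(4)[of z] g(4)[of z] by (auto intro!: q0 f(1,2) g(1,2))
    also have "\<dots> \<le> q * \<bar>f z - g z\<bar>"
      using True z q by (intro mult_left_mono max) auto
    finally show ?thesis .
  next
    case False
    have "f z - g z = (1 - t) * mob k1 (f (2 * z - 1)) - (1 - t) * mob k1 (g (2 * z - 1))"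
      using False z f(5)[of z] g(5)[of z] by simp
    then have "\<bar>f z - g z\<bar> \<le> q * \<bar>f (2 * z - 1) - g (2 * z - 1)\<bar>"
      using False z by (auto intro!: q1 f(1,2) g(1,2))
    also have "\<dots> \<le> q * \<bar>f z - g z\<bar>"
      using False z q by (intro mult_left_mono max) auto
    finally show ?thesis .
  qed
  then have "\<bar>f z - g z\<bar> = 0"
    using q by (intro le_mult_less_one_imp_zero[of _ q]) auto
  then show ?thesis using max[of x] x by simp
qed

text \<open>The functional equation makes \<open>f 0\<close> and \<open>f 1\<close> fixed points of
  the two contractions, whose fixed points in \<open>[0, 1]\<close> are 0 and 1
  respectively.\<close>

lemma solution_endpoints:
  assumes f: "solution f"
  shows "f 0 = 0" "f 1 = 1"
proof -
  obtain q where q: "0 \<le> q" "q < 1"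
    and q0: "\<And>x y. \<lbrakk>0 \<le> x; x \<le> 1; 0 \<le> y; y \<le> 1\<rbrakk> \<Longrightarrow> \<bar>t * mob k0 x - t * mob k0 y\<bar> \<le> q * \<bar>x - y\<bar>"
    and q1: "\<And>x y. \<lbrakk>0 \<le> x; x \<le> 1; 0 \<le> y; y \<le> 1\<rbrakk> \<Longrightarrow>
      \<bar>(1 - t) * mob k1 x - (1 - t) * mob k1 y\<bar> \<le> q * \<bar>x - y\<bar>"
    using contraction by blast
  note f = solutionD[OF f]
  have fix0: "t * mob k0 (f 0) = f 0"
    using f(4)[of 0, symmetric] by simp
  have "\<bar>f 0 - 0\<bar> \<le> q * \<bar>f 0 - 0\<bar>"
    using q0[of "f 0" 0] f(1,2)[of 0] by (simp add: fix0)
  then show "f 0 = 0"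
    using q le_mult_less_one_imp_zero[of "\<bar>f 0 - 0\<bar>" q] by simp
  have "(1 - t) * mob k1 (f 1) - (1 - t) * mob k1 1 = f 1 - 1"
    using f(5)[of 1, symmetric] k_pos by simp
  then have "\<bar>f 1 - 1\<bar> \<le> q * \<bar>f 1 - 1\<bar>"
    using q1[of "f 1" 1] f(1,2)[of 1] by (simp only: zero_le_one order_refl)
  then show "f 1 = 1"
    using q le_mult_less_one_imp_zero[of "\<bar>f 1 - 1\<bar>" q] by simp
qed

subsection \<open>The balanced case\<close>

text \<open>A solution takes the value \<open>t\<close> at 1/2, and
  \<open>mob v (1/2) = v / (1 + v)\<close>, which leaves \<open>v = t / (1 - t)\<close> as the only
  candidate. The functional equation is then checked directly.\<close>

lemma solution_mob:
  assumes "2 * t * k0 = 1" "k1 = 2 * (1 - t)"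
  shows "solution (mob (t / (1 - t)))"
proof -
  define v where "v = t / (1 - t)"
  have v: "0 < v" using t by (simp add: v_def)
  have k0: "k0 = 1 / (2 * t)" using assms t by (simp add: field_simps)
  \<comment> \<open>Clearing the factor \<open>1 - t\<close> gives a form symmetric under exchanging
    \<open>t\<close>, \<open>x\<close> with \<open>1 - t\<close>, \<open>1 - x\<close> in its
    denominator.\<close>
  have mob_v: "mob v x = t * x / ((1 - t) * (1 - x) + t * x)" for x
  proof -
    have "(1 - t) * (1 - x + v * x) = (1 - t) * (1 - x) + t * x"
      using t by (simp add: v_def field_simps)
    moreover have "(1 - t) * (v * x) = t * x" using t by (simp add: v_def)
    moreover have "mob v x = ((1 - t) * (v * x)) / ((1 - t) * (1 - x + v * x))"
      using t by (simp add: mob_def)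
    ultimately show ?thesis by simp
  qed
  have den: "0 < (1 - t) * (1 - x) + t * x" if "0 \<le> x" "x \<le> 1" for x
  proof (cases "x = 0")
    case False
    then show ?thesis using that t by (intro add_nonneg_pos mult_pos_pos mult_nonneg_nonneg) auto
  qed (use t in simp)
  have "mob v x = t * mob k0 (mob v (2 * x))" if x: "0 \<le> x" "x \<le> 1/2" for x
  proof -
    define d where "d = (1 - t) * (1 - 2 * x) + t * (2 * x)"
    have d: "0 < d" using den[of "2 * x"] x by (simp add: d_def)
    have e: "0 < (1 - t) * (1 - x) + t * x" using den[of x] x by simp
    have y: "mob v (2 * x) = t * (2 * x) / d" by (simp add: mob_v d_def)
    have "1 - mob v (2 * x) = (1 - t) * (1 - 2 * x) / d"
      using d unfolding y by (simp add: field_simps) (simp add: d_def algebra_simps)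
    moreover have "k0 * mob v (2 * x) = x / d"
      using t by (simp add: y k0)
    ultimately have "mob k0 (mob v (2 * x)) = (x / d) / (((1 - t) * (1 - 2 * x) + x) / d)"
      unfolding mob_def[of k0] by (simp add: add_divide_distrib)
    also have "\<dots> = x / ((1 - t) * (1 - x) + t * x)"
      using d by (simp add: algebra_simps)
    finally show ?thesis by (simp add: mob_v)
  qed
  moreover have "mob v x = t + (1 - t) * mob k1 (mob v (2 * x - 1))" if x: "1/2 \<le> x" "x \<le> 1" for x
  proof -
    define z where "z = 2 * x - 1"
    define d where "d = (1 - t) * (1 - z) + t * z"
    have z: "0 \<le> z" "z \<le> 1" using x by (auto simp: z_def)
    have d: "0 < d" using den[of z] z by (simp add: d_def)
    have e: "0 < (1 - t) * (1 - x) + t * x" using den[of x] x by simp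
    have y: "mob v z = t * z / d" by (simp add: mob_v d_def)
    have "1 - mob v z = (1 - t) * (1 - z) / d"
      using d unfolding y by (simp add: field_simps) (simp add: d_def algebra_simps)
    moreover have "k1 * mob v z = (1 - t) * (2 * t * z) / d"
      by (simp add: y assms(2))
    ultimately have "mob k1 (mob v z)
        = ((1 - t) * (2 * t * z) / d) / ((1 - t) * (1 - z + 2 * t * z) / d)"
      unfolding mob_def[of k1] by (simp add: add_divide_distrib[symmetric] distrib_left)
    also have "\<dots> = 2 * t * z / (1 - z + 2 * t * z)"
      using d t by simp
    also have "1 - z + 2 * t * z = 2 * ((1 - t) * (1 - x) + t * x)"
      by (simp add: z_def algebra_simps)
    also have "2 * t * z / (2 * ((1 - t) * (1 - x) + t * x)) = t * z / ((1 - t) * (1 - x) + t * x)"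
      unfolding mult.assoc by (rule mult_divide_mult_cancel_left) simp
    finally have "mob k1 (mob v z) = t * z / ((1 - t) * (1 - x) + t * x)" .
    then have "t + (1 - t) * mob k1 (mob v z)
        = (t * ((1 - t) * (1 - x) + t * x) + (1 - t) * (t * z)) / ((1 - t) * (1 - x) + t * x)"
      using e by (simp add: add_divide_distrib)
    also have "t * ((1 - t) * (1 - x) + t * x) + (1 - t) * (t * z) = t * x"
      by (simp add: z_def algebra_simps)
    finally have "t + (1 - t) * mob k1 (mob v z) = t * x / ((1 - t) * (1 - x) + t * x)" .
    then show ?thesis by (simp add: mob_v z_def)
  qed
  ultimately show ?thesis
    unfolding solution_def v_def[symmetric] using v mob_range[of v] mob_continuous[of v]
    by (auto simp: image_subset_iff)
qed


subsection \<open>The unbalanced case\<close>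

text \<open>The maps \<open>H0\<close>, \<open>H1\<close> send the state of a dyadic interval to that of its left, right
  half; \<open>mass f u n j\<close> is the mass of the \<open>j\<close>-th interval of level \<open>n\<close> when the state is \<open>u\<close>, and
  \<open>u = 1\<close> for the whole unit interval.\<close>

definition den :: "real \<Rightarrow> real" where "den u = 1 - t + u * t"
definition H0 :: "real \<Rightarrow> real" where "H0 u = k0 * den u"
definition H1 :: "real \<Rightarrow> real" where "H1 u = k1 * u / den u"

lemma den_pos: "0 < u \<Longrightarrow> 0 < den u"
  unfolding den_def using t by (intro convex_comb_pos) auto

lemma H_pos: "0 < u \<Longrightarrow> 0 < H0 u" "0 < u \<Longrightarrow> 0 < H1 u"
  using den_pos k_pos by (auto simp: H0_def H1_def)

lemma split_prob: "0 \<le> mob u t" "mob u t \<le> 1" if "0 < u"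
  using mob_range[of u t] t that by auto

text \<open>The scaling identity for \<open>mob\<close> extends the functional equation from
  \<open>f\<close> to all \<open>mob u\<close> composed with \<open>f\<close>, a family closed under
  restriction to halves and rescaling.\<close>

lemma mob_solution_left:
  assumes f: "solution f" and "0 < u" "0 \<le> y" "y \<le> 1"
  shows "mob u (f (y / 2)) = mob u t * mob (H0 u) (f y)"
proof -
  have "f (y / 2) = t * mob k0 (f y)"
    using solutionD(4)[OF f, of "y / 2"] assms by simp
  then show ?thesis
    using mob_scaled_mob[of u k0 t "f y"] assms t k_pos solutionD(1,2)[OF f, of y]
    by (simp add: H0_def den_def)
qed

lemma mob_solution_right:
  assumes f: "solution f" and "0 < u" "0 \<le> y" "y \<le> 1"
  shows "mob u (f ((1 + y) / 2)) = mob u t + (1 - mob u t) * mob (H1 u) (f y)"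
proof -
  have "f ((1 + y) / 2) = t + (1 - t) * mob k1 (f y)"
    using solutionD(5)[OF f, of "(1 + y) / 2"] assms by (simp add: field_simps)
  then show ?thesis
    using mob_shifted_mob[of u k1 t "f y"] assms t k_pos solutionD(1,2)[OF f, of y]
    by (simp add: H1_def den_def)
qed

definition mass :: "(real \<Rightarrow> real) \<Rightarrow> real \<Rightarrow> nat \<Rightarrow> nat \<Rightarrow> real" where
  "mass f u n j = mob u (f ((real j + 1) / 2^n)) - mob u (f (real j / 2^n))"

lemma dyadic_bounds:
  assumes "j < 2^n"
  shows "0 \<le> real j / 2^n" "real j / 2^n \<le> 1" "0 \<le> (real j + 1) / 2^n" "(real j + 1) / 2^n \<le> 1"
proof -
  have "real (Suc j) \<le> real (2^n)" using assms by (intro of_nat_mono) simp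
  then have "real j + 1 \<le> 2^n" by simp
  then show "(real j + 1) / 2^n \<le> 1" "real j / 2^n \<le> 1"
    using assms by (simp_all add: divide_le_eq_1)
qed simp_all

lemma mass_left:
  assumes f: "solution f" and "0 < u" "j < 2^n"
  shows "mass f u (Suc n) j = mob u t * mass f (H0 u) n j"
proof -
  have "(real j + 1) / 2^(Suc n) = (real j + 1) / 2^n / 2" "real j / 2^(Suc n) = real j / 2^n / 2"
    by simp_all
  then show ?thesis
    using mob_solution_left[OF f \<open>0 < u\<close>] dyadic_bounds[OF \<open>j < 2^n\<close>]
    by (simp only: mass_def right_diff_distrib)
qed

lemma mass_right:
  assumes f: "solution f" and "0 < u" "j < 2^n"
  shows "mass f u (Suc n) (2^n + j) = (1 - mob u t) * mass f (H1 u) n j"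
proof -
  have eqs: "(real (2^n + j) + 1) / 2^(Suc n) = (1 + (real j + 1) / 2^n) / 2"
    "real (2^n + j) / 2^(Suc n) = (1 + real j / 2^n) / 2"
    by (simp_all add: field_simps)
  have "mass f u (Suc n) (2^n + j)
      = (mob u t + (1 - mob u t) * mob (H1 u) (f ((real j + 1) / 2^n)))
        - (mob u t + (1 - mob u t) * mob (H1 u) (f (real j / 2^n)))"
    unfolding mass_def eqs
    using mob_solution_right[OF f \<open>0 < u\<close>] dyadic_bounds[OF \<open>j < 2^n\<close>] by simp
  then show ?thesis by (simp add: mass_def right_diff_distrib)
qed

section \<open>Hellinger sums of the dyadic masses and their growth\<close>

text \<open>For a solution and \<open>u > 0\<close>, division by \<open>sqrt (2^n)\<close> gives the
  Hellinger affinity between the masses of level \<open>n\<close> and the uniform distribution.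
  Cauchy-Schwarz bounds the sum by \<open>sqrt (2^n)\<close>; the aim is an exponentially better
  bound.\<close>

definition hellinger :: "(real \<Rightarrow> real) \<Rightarrow> real \<Rightarrow> nat \<Rightarrow> real" where
  "hellinger f u n = (\<Sum>j<2^n. sqrt (mass f u n j))"

lemma hellinger_0:
  assumes "solution f" "0 < u"
  shows "hellinger f u 0 = 1"
  using assms by (simp add: hellinger_def mass_def solution_endpoints)

lemma hellinger_Suc:
  assumes f: "solution f" and u: "0 < u"
  shows "hellinger f u (Suc n)
    = sqrt (mob u t) * hellinger f (H0 u) n + sqrt (1 - mob u t) * hellinger f (H1 u) n"
proof -
  have "hellinger f u (Suc n)
      = (\<Sum>j<2^n. sqrt (mass f u (Suc n) j)) + (\<Sum>j<2^n. sqrt (mass f u (Suc n) (2^n + j)))"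
    using sum_lessThan_add[of "\<lambda>j. sqrt (mass f u (Suc n) j)" "2^n" "2^n"]
    by (simp add: hellinger_def mult_2)
  also have "(\<Sum>j<2^n. sqrt (mass f u (Suc n) j)) = sqrt (mob u t) * hellinger f (H0 u) n"
    unfolding hellinger_def sum_distrib_left
    by (intro sum.cong refl) (simp add: mass_left[OF f u] real_sqrt_mult)
  also have "(\<Sum>j<2^n. sqrt (mass f u (Suc n) (2^n + j))) = sqrt (1 - mob u t) * hellinger f (H1 u) n"
    unfolding hellinger_def sum_distrib_left
    by (intro sum.cong refl) (simp add: mass_right[OF f u] real_sqrt_mult)
  finally show ?thesis .
qed

text \<open>For a solution and \<open>u > 0\<close> this is \<open>hellinger f u 1\<close>, and
  \<open>growth2 u\<close> is \<open>hellinger f u 2\<close>. Two levels are taken together because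
  a single one is lossless whenever \<open>mob u t = 1/2\<close>.\<close>

definition growth :: "real \<Rightarrow> real" where
  "growth u = sqrt (mob u t) + sqrt (1 - mob u t)"

definition growth2 :: "real \<Rightarrow> real" where
  "growth2 u = sqrt (mob u t) * growth (H0 u) + sqrt (1 - mob u t) * growth (H1 u)"

lemma hellinger_two_steps_le:
  assumes f: "solution f" and u: "0 < u"
    and C: "\<And>h h'. h \<in> {H0, H1} \<Longrightarrow> h' \<in> {H0, H1} \<Longrightarrow> hellinger f (h (h' u)) n \<le> C"
  shows "hellinger f u (Suc (Suc n)) \<le> growth2 u * C"
proof -
  have step: "hellinger f v (Suc n) \<le> growth v * C"
    if "0 < v" "hellinger f (H0 v) n \<le> C" "hellinger f (H1 v) n \<le> C" for v
    unfolding hellinger_Suc[OF f \<open>0 < v\<close>] growth_def distrib_right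
    using that split_prob[of v] by (intro add_mono mult_left_mono) auto
  have "hellinger f u (Suc (Suc n))
      = sqrt (mob u t) * hellinger f (H0 u) (Suc n) + sqrt (1 - mob u t) * hellinger f (H1 u) (Suc n)"
    by (rule hellinger_Suc[OF f u])
  also have "\<dots> \<le> sqrt (mob u t) * (growth (H0 u) * C) + sqrt (1 - mob u t) * (growth (H1 u) * C)"
    using split_prob[OF u] H_pos u C by (intro add_mono mult_left_mono step) auto
  finally show ?thesis by (simp add: growth2_def algebra_simps)
qed

lemma growth_le: "0 < u \<Longrightarrow> growth u \<le> sqrt 2"
  unfolding growth_def by (intro sqrt_sum_le split_prob)

lemma growth_eqD:
  assumes "0 < u" "growth u = sqrt 2"
  shows "mob u t = 1/2" "u * t = 1 - t"
proof -
  show half: "mob u t = 1/2"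
    using assms split_prob[of u] unfolding growth_def by (intro sqrt_sum_le(2))
  then show "u * t = 1 - t"
    using den_pos[OF assms(1)] by (simp add: mob_def den_def field_simps)
qed

text \<open>Both steps of \<open>growth2\<close> are lossless only at a state \<open>u\<close> with \<open>mob u t = 1/2\<close> that is fixed
  by \<open>H0\<close> and \<open>H1\<close>.\<close>

lemma growth2_less:
  assumes u: "0 < u" and unbalanced: "2 * t * k0 \<noteq> 1 \<or> k1 \<noteq> 2 * (1 - t)"
  shows "growth2 u < 2"
proof (cases "growth u = sqrt 2")
  case False
  then have less: "growth u < sqrt 2" using growth_le[OF u] by simp
  \<comment> \<open>The first subdivision already loses, so the trivial bound is enough for the
    second.\<close>
  have "growth2 u \<le> sqrt (mob u t) * sqrt 2 + sqrt (1 - mob u t) * sqrt 2"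
    unfolding growth2_def using split_prob[OF u] H_pos u
    by (intro add_mono mult_left_mono growth_le) auto
  also have "\<dots> = growth u * sqrt 2" by (simp add: growth_def distrib_right)
  also have "\<dots> < sqrt 2 * sqrt 2" using less by (intro mult_strict_right_mono) auto
  finally show ?thesis by simp
next
  case True
  note half = growth_eqD[OF u True]
  have den: "den u = 2 * (1 - t)" using half by (simp add: den_def)
  \<comment> \<open>If both halves were lossless too, then
    \<open>H0 u = H1 u = u = (1 - t) / t\<close>, which forces both balance equations.\<close>
  have "growth (H0 u) \<noteq> sqrt 2 \<or> growth (H1 u) \<noteq> sqrt 2"
  proof (rule ccontr)
    assume "\<not> ?thesis"
    then have *: "H0 u * t = 1 - t" "H1 u * t = 1 - t"
      using growth_eqD(2) H_pos u by auto
    have "(2 * t * k0) * (1 - t) = 1 * (1 - t)"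
      using *(1) by (simp add: H0_def den mult_ac)
    then have eq0: "2 * t * k0 = 1" using t by simp
    have "k1 * (u * t) / (2 * (1 - t)) = 1 - t"
      using *(2) by (simp add: H1_def den mult_ac)
    moreover have "k1 * (u * t) / (2 * (1 - t)) = k1 / 2"
      unfolding half(2) using t mult_divide_mult_cancel_right[of "1 - t" k1 2] by simp
    ultimately have "k1 / 2 = 1 - t" by simp
    then have "k1 = 2 * (1 - t)" by simp
    with eq0 show False using unbalanced by simp
  qed
  then have "growth (H0 u) + growth (H1 u) < sqrt 2 + sqrt 2"
    using growth_le[of "H0 u"] growth_le[of "H1 u"] H_pos u by fastforce
  then have "sqrt (1/2) * (growth (H0 u) + growth (H1 u)) < sqrt (1/2) * (sqrt 2 + sqrt 2)"
    by (intro mult_strict_left_mono) auto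
  also have "\<dots> = 2" by (simp add: real_sqrt_divide)
  finally show ?thesis by (simp add: growth2_def half distrib_left)
qed

text \<open>This provides a compact set of states that contains the initial state 1 and stays away
  from 0, so that the pointwise bound on \<open>growth2\<close> becomes uniform.\<close>

lemma invariant_interval:
  obtains a b where "0 < a" "a \<le> 1" "1 \<le> b"
    "\<And>u. a \<le> u \<Longrightarrow> u \<le> b \<Longrightarrow> a \<le> H0 u \<and> H0 u \<le> b \<and> a \<le> H1 u \<and> H1 u \<le> b"
proof -
  \<comment> \<open>The positive fixed points of \<open>H0\<close> and \<open>H1\<close>, both attracting.\<close>
  define e0 where "e0 = k0 * (1 - t) / (1 - t * k0)"
  define e1 where "e1 = (k1 - (1 - t)) / t"
  define a where "a = min 1 (min e0 e1)"
  define b where "b = max 1 (max e0 e1)"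
  have e: "0 < e0" "0 < e1" using t k0 k1 k_pos by (auto simp: e0_def e1_def)
  have a: "0 < a" "a \<le> 1" "a \<le> e0" "a \<le> e1" using e by (auto simp: a_def)
  have b: "1 \<le> b" "e0 \<le> b" "e1 \<le> b" by (auto simp: b_def)
  have "a \<le> H0 u \<and> H0 u \<le> b \<and> a \<le> H1 u \<and> H1 u \<le> b" if u: "a \<le> u" "u \<le> b" for u
  proof -
    have u0: "0 < u" using a u by simp
    have "(1 - t * k0) * e0 = k0 * (1 - t)" using k0 by (simp add: e0_def)
    \<comment> \<open>\<open>H0\<close> is affine with slope \<open>t * k0\<close> in
      \<open>(0, 1)\<close>, so \<open>H0 u\<close> is a convex combination of \<open>u\<close> and
      the fixed point \<open>e0\<close>.\<close>
    then have "H0 u = (t * k0) * u + (1 - t * k0) * e0"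
      by (simp add: H0_def den_def algebra_simps)
    moreover have "(t * k0) * a + (1 - t * k0) * a \<le> (t * k0) * u + (1 - t * k0) * e0"
      "(t * k0) * u + (1 - t * k0) * e0 \<le> (t * k0) * b + (1 - t * k0) * b"
      using t k0 k_pos a b u by (auto intro!: add_mono mult_left_mono)
    ultimately have "a \<le> H0 u" "H0 u \<le> b" by (simp_all add: algebra_simps)
    \<comment> \<open>After multiplication by \<open>den u\<close>, the bound
      \<open>a \<le> H1 u\<close> reads \<open>(1 - t) * a \<le> (k1 - a * t) * u\<close>.
      Comparison of \<open>a\<close> with \<open>e1\<close> controls the coefficient on the right;
      the bound by \<open>b\<close> is analogous.\<close>
    have at: "1 - t \<le> k1 - a * t" "k1 - b * t \<le> 1 - t"
    proof -
      have "a * t \<le> e1 * t" "e1 * t \<le> b * t" using a b t by auto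
      then show "1 - t \<le> k1 - a * t" "k1 - b * t \<le> 1 - t" using t by (auto simp: e1_def)
    qed
    have "(1 - t) * a \<le> (1 - t) * u" using t u by simp
    also have "\<dots> \<le> (k1 - a * t) * u" using at u0 by (intro mult_right_mono) auto
    finally have "a * den u \<le> k1 * u" by (simp add: den_def algebra_simps)
    moreover have "(k1 - b * t) * u \<le> (1 - t) * u" using at u0 by (intro mult_right_mono) auto
    moreover have "(1 - t) * u \<le> (1 - t) * b" using t u by simp
    ultimately have "a * den u \<le> k1 * u" "k1 * u \<le> b * den u"
      by (simp_all add: den_def algebra_simps)
    then have "a \<le> H1 u" "H1 u \<le> b"
      using den_pos[OF u0] by (simp_all add: H1_def field_simps)
    with \<open>a \<le> H0 u\<close> \<open>H0 u \<le> b\<close> show ?thesis by blast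
  qed
  then show ?thesis using that[of a b] a b by blast
qed

lemma growth2_continuous:
  assumes "0 < a"
  shows "continuous_on {a..b} growth2"
proof -
  have "den u \<noteq> 0" "1 - t + u * t \<noteq> 0" "1 - t + H0 u * t \<noteq> 0" "1 - t + H1 u * t \<noteq> 0"
    if "u \<in> {a..b}" for u
    using that assms den_pos[of u] den_pos[OF H_pos(1), of u] den_pos[OF H_pos(2), of u]
    by (auto simp: den_def)
  note nz = this
  have den: "continuous_on {a..b} den"
    unfolding den_def[abs_def] by (intro continuous_intros)
  have H: "continuous_on {a..b} H0" "continuous_on {a..b} H1"
    unfolding H0_def[abs_def] H1_def[abs_def] using nz(1) by (auto intro!: continuous_intros den)
  have mob_comp: "continuous_on {a..b} (\<lambda>u. mob (h u) t)"
    if "continuous_on {a..b} h" "\<And>u. u \<in> {a..b} \<Longrightarrow> 1 - t + h u * t \<noteq> 0" for h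
    unfolding mob_def using that by (intro continuous_intros) auto
  show ?thesis
    unfolding growth2_def[abs_def] growth_def
    by (intro continuous_intros mob_comp H nz)
qed

lemma hellinger_exponential_bound:
  assumes "2 * t * k0 \<noteq> 1 \<or> k1 \<noteq> 2 * (1 - t)"
  obtains L where "0 < L" "L < 1" "\<And>f n. solution f \<Longrightarrow> hellinger f 1 (2 * n) \<le> (2 * L)^n"
proof -
  obtain a b where ab: "0 < a" "a \<le> 1" "1 \<le> b"
    and inv: "\<And>u. a \<le> u \<Longrightarrow> u \<le> b \<Longrightarrow> a \<le> H0 u \<and> H0 u \<le> b \<and> a \<le> H1 u \<and> H1 u \<le> b"
    using invariant_interval by blast
  obtain w where w: "w \<in> {a..b}" and max: "\<And>u. u \<in> {a..b} \<Longrightarrow> growth2 u \<le> growth2 w"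
    using continuous_attains_sup[OF _ _ growth2_continuous[OF ab(1), of b]] ab by auto
  \<comment> \<open>The maximum with 1/2 makes \<open>L\<close> positive; the other term is below 1
    because \<open>growth2 w < 2\<close>.\<close>
  define L where "L = max (1/2) (growth2 w / 2)"
  have L: "0 < L" "L < 1"
    using growth2_less[OF _ assms, of w] w ab by (auto simp: L_def)
  have growth2_L: "growth2 u \<le> 2 * L" if "u \<in> {a..b}" for u
    using max[OF that] by (simp add: L_def)
  \<comment> \<open>The induction runs over all states in the invariant interval, since two
    subdivisions replace \<open>u\<close> by four other states.\<close>
  have "hellinger f u (2 * n) \<le> (2 * L)^n" if f: "solution f" and u: "a \<le> u" "u \<le> b" for f n u
    using u
  proof (induction n arbitrary: u)
    case 0
    then show ?case using hellinger_0[OF f, of u] ab by simp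
  next
    case (Suc n)
    have "hellinger f u (Suc (Suc (2 * n))) \<le> growth2 u * (2 * L)^n"
    proof (rule hellinger_two_steps_le[OF f])
      show "0 < u" using Suc.prems ab by simp
      fix h h' :: "real \<Rightarrow> real" assume "h \<in> {H0, H1}" "h' \<in> {H0, H1}"
      then show "hellinger f (h (h' u)) (2 * n) \<le> (2 * L)^n"
        using inv[of u] inv[of "h' u"] Suc.prems by (intro Suc.IH) auto
    qed
    also have "\<dots> \<le> 2 * L * (2 * L)^n"
      using growth2_L[of u] Suc.prems L by (intro mult_right_mono) auto
    finally show ?case by simp
  qed
  then show ?thesis using that[OF L] ab by blast
qed

lemma unbalanced_imp_small_dim:
  assumes f: "solution f" "mono_on {0..1} f"
    and "2 * t * k0 \<noteq> 1 \<or> k1 \<noteq> 2 * (1 - t)"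
  obtains K where "K \<in> sets (mu_of f)" "emeasure (mu_of f) K = 1" "hausdorff_dim K < 1"
    "emeasure lborel K = 0"
proof -
  obtain L where L: "0 < L" "L < 1" "\<And>f n. solution f \<Longrightarrow> hellinger f 1 (2 * n) \<le> (2 * L)^n"
    using hellinger_exponential_bound[OF assms(3)] by blast
  have "(\<Sum>j<4^n. sqrt (f ((real j + 1) / 4^n) - f (real j / 4^n))) \<le> (2 * L)^n" for n
  proof -
    \<comment> \<open>Level \<open>2 * n\<close> of the dyadic grid is level \<open>n\<close> of the
      grid with base 4, and \<open>mob 1\<close> is the identity, so the masses at state 1 are the
      increments of \<open>f\<close>.\<close>
    have "(2::real)^(2 * n) = 4^n" "(2::nat)^(2 * n) = 4^n" by (simp_all add: power_mult)
    then show ?thesis using L(3)[OF f(1), of n] by (simp add: hellinger_def mass_def)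
  qed
  then show ?thesis
    using hellinger_sum_imp_small_dim[OF solutionD(3)[OF f(1)] f(2) solution_endpoints[OF f(1)] L(1,2)]
      that by blast
qed

end

section \<open>The density of a Moebius distribution function\<close>

text \<open>The density is the derivative of \<open>mob v\<close>, so the fundamental theorem of
  calculus gives equal values on all intervals \<open>{0..x}\<close>.\<close>

lemma mu_of_mob:
  assumes v: "0 < v" and f: "\<And>x. 0 \<le> x \<Longrightarrow> x \<le> 1 \<Longrightarrow> f x = mob v x"
  shows "mu_of f = density lborel01 (\<lambda>x. ennreal (v / (1 - x + v * x)\<^sup>2))"
proof (rule measure_eqI_unit_interval)
  have "continuous_on {0..1} f \<longleftrightarrow> continuous_on {0..1} (mob v)"
    using f by (intro continuous_on_cong) auto
  then have cont: "continuous_on {0..1} f" using mob_continuous[OF v] by simp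
  have mono: "mono_on {0..1} f"
    by (intro mono_onI) (use f mob_mono[OF v] in auto)
  have mu: "emeasure (mu_of f) {0..x} = ennreal (mob v x)" if "0 \<le> x" "x \<le> 1" for x
    using emeasure_mu_of_Icc[OF cont mono, of x] f v that by simp
  show "sets (mu_of f) = sets lborel01" by (rule sets_mu_of)
  show "sets (density lborel01 (\<lambda>x. ennreal (v / (1 - x + v * x)\<^sup>2))) = sets lborel01" by simp
  show "emeasure (mu_of f) {0..1} < \<infinity>" using mu[of 1] by simp
  fix x :: real assume x: "0 \<le> x" "x \<le> 1"
  have "emeasure (density lborel01 (\<lambda>x. ennreal (v / (1 - x + v * x)\<^sup>2))) {0..x}
      = (\<integral>\<^sup>+y. ennreal (v / (1 - y + v * y)\<^sup>2) * indicator {0..x} y \<partial>lborel01)"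
    using x by (intro emeasure_density) (auto simp: sets_restrict_space_iff intro!: measurable_restrict_space1)
  also have "\<dots> = (\<integral>\<^sup>+y. ennreal (v / (1 - y + v * y)\<^sup>2) * indicator {0..x} y * indicator {0..1} y \<partial>lborel)"
    by (rule nn_integral_restrict_space) simp
  also have "\<dots> = (\<integral>\<^sup>+y. ennreal (v / (1 - y + v * y)\<^sup>2) * indicator {0..x} y \<partial>lborel)"
    using x by (intro nn_integral_cong) (auto split: split_indicator)
  also have "\<dots> = ennreal (mob v x - mob v 0)"
  proof (rule nn_integral_FTC_Icc)
    fix y assume "y \<in> {0..x}"
    then have pos: "0 < 1 - y + v * y" using x v by (intro convex_comb_pos) auto
    show "DERIV (mob v) y :> v / (1 - y + v * y)\<^sup>2"
      unfolding mob_def[abs_def]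
      by (rule derivative_eq_intros refl | use pos in force)+
        (use pos in \<open>simp add: power2_eq_square algebra_simps\<close>)
    show "0 \<le> v / (1 - y + v * y)\<^sup>2" using v by simp
  qed (use x in auto)
  finally show "emeasure (mu_of f) {0..x} = emeasure (density lborel01 (\<lambda>x. ennreal (v / (1 - x + v * x)\<^sup>2))) {0..x}"
    using x by (simp add: mu)
qed

lemma emeasure_lborel01: "emeasure lborel01 K = emeasure lborel K" if "K \<subseteq> {0..1}"
  using that by (intro emeasure_restrict_space) auto

section \<open>Translation of the matrix conditions into the normal form\<close>

theorem theorem1p2:
  fixes A0 A1 :: "real^2^2"
    and a0 b0 c0 d0 a1 b1 c1 d1 :: real
    and f :: "real \<Rightarrow> real"
  assumes "A0 = vector [vector [a0, b0], vector [c0, d0]]"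
    and "A1 = vector [vector [a1, b1], vector [c1, d1]]"
    and "0 = b0" "b0 < (a0 + b0) / (c0 + d0)" "(a0 + b0) / (c0 + d0) = b1 / d1"
        "b1 / d1 < (a1 + b1) / (c1 + d1)" "(a1 + b1) / (c1 + d1) = 1"
    and "a0 * d0 - b0 * c0 > 0" "a1 * d1 - b1 * c1 > 0"
    and "sqrt (a0 * d0 - b0 * c0) < min d0 (c0 + d0)"
        "sqrt (a1 * d1 - b1 * c1) < min d1 (c1 + d1)"
    and "de_rham_function A0 A1 f"
  shows
    "((c0 + d0 - 2 * a0) * (d0 - a0) = a0 * c0 \<and> (a1 - 2 * c1) * (d1 - 2 * b1) = b1 * c1 \<longrightarrow>
        mu_of f = density lborel01
          (\<lambda>x. ennreal ((1 + 2 * (c0 / d0)) / (- 2 * (c0 / d0) * x + 1 + 2 * (c0 / d0))\<^sup>2)) \<and>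
        absolutely_continuous lborel01 (mu_of f)) \<and>
     ((c0 + d0 - 2 * a0) * (d0 - a0) \<noteq> a0 * c0 \<or> (a1 - 2 * c1) * (d1 - 2 * b1) \<noteq> b1 * c1 \<longrightarrow>
        (\<exists>K1 \<in> sets (mu_of f). emeasure (mu_of f) K1 = 1 \<and> hausdorff_dim K1 < 1) \<and>
        mutually_singular lborel01 (mu_of f))"
proof -
  let ?P = "(c0 + d0 - 2 * a0) * (d0 - a0) = a0 * c0"
  let ?Q = "(a1 - 2 * c1) * (d1 - 2 * b1) = b1 * c1"
  note A = assms
  \<comment> \<open>\<open>t\<close> is the common value of the first map at 1 and the second at 0.
    Once the endpoint values are fixed, a Moebius map has one parameter left, the ratio of its
    denominators at 1 and at 0, which gives \<open>k0\<close> and \<open>k1\<close>.\<close>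
  define t where "t = a0 / (c0 + d0)"
  define k0 where "k0 = (c0 + d0) / d0"
  define k1 where "k1 = (c1 + d1) / d1"
  have b0: "b0 = 0" using A(3) by simp
  have det: "0 < a0 * d0" "0 < a1 * d1 - b1 * c1"
    using A(8,9) b0 by simp_all
  have sqrt_det: "0 < sqrt (a0 * d0)" "sqrt (a0 * d0) < d0" "sqrt (a0 * d0) < c0 + d0"
    "0 < sqrt (a1 * d1 - b1 * c1)" "sqrt (a1 * d1 - b1 * c1) < d1" "sqrt (a1 * d1 - b1 * c1) < c1 + d1"
    using det A(10,11) b0 by simp_all
  then have pos: "0 < d0" "0 < c0 + d0" "0 < d1" "0 < c1 + d1" by linarith+
  have a0: "0 < a0" using det(1) pos(1) by (simp add: zero_less_mult_iff)
  have sq: "x < y\<^sup>2" if "0 < x" "sqrt x < y" for x y :: real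
    using power_strict_mono[OF that(2), of 2] that(1) by simp
  have det_less: "a0 * d0 < d0\<^sup>2" "a0 * d0 < (c0 + d0)\<^sup>2"
    "a1 * d1 - b1 * c1 < d1\<^sup>2" "a1 * d1 - b1 * c1 < (c1 + d1)\<^sup>2"
    using sq sqrt_det det by auto
  have a1: "a1 = c1 + d1 - b1" using A(7) pos by (simp add: field_simps)
  have tb: "t = b1 / d1" using A(5) b0 by (simp add: t_def)
  have t: "0 < t" "t < 1"
    using A(4,5,6,7) b0 by (simp_all add: t_def)
  have b1: "b1 = t * d1" using pos by (simp add: tb)
  have a0': "a0 = t * (c0 + d0)" using pos by (simp add: t_def)
  have "b1 < d1" using t pos b1 by simp
  have "a0 < c0 + d0" using t pos a0' by simp
  interpret mob_system t k0 k1
  proof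
    show "0 < t" "t < 1" by (rule t)+
    \<comment> \<open>The determinants are \<open>t * (c0 + d0) * d0\<close> and
      \<open>(1 - t) * (c1 + d1) * d1\<close>. Squaring (A3) and cancelling a positive factor yields
      the four inequalities on \<open>k0\<close> and \<open>k1\<close>.\<close>
    have "t * d0 * (c0 + d0) < (c0 + d0) * (c0 + d0)"
      using det_less(2) by (simp add: a0' power2_eq_square mult_ac)
    then have "t * d0 < c0 + d0" using pos by (simp only: mult_less_cancel_right_pos)
    then show "t < k0" using pos by (simp add: k0_def pos_less_divide_eq)
    have "a0 < d0" using det_less(1) pos by (simp add: power2_eq_square)
    then show "t * k0 < 1" using pos by (simp add: t_def k0_def)
    have det1: "a1 * d1 - b1 * c1 = (1 - t) * (c1 + d1) * d1"
      by (simp add: a1 b1 algebra_simps)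
    have "(1 - t) * d1 * (c1 + d1) < (c1 + d1) * (c1 + d1)"
      using det_less(4) unfolding det1 by (simp only: power2_eq_square mult_ac)
    then have "(1 - t) * d1 < c1 + d1" using pos by (simp only: mult_less_cancel_right_pos)
    then show "1 - t < k1" using pos by (simp add: k1_def pos_less_divide_eq)
    have "(1 - t) * (c1 + d1) * d1 < d1 * d1"
      using det_less(3) unfolding det1 by (simp only: power2_eq_square)
    then have "(1 - t) * (c1 + d1) < d1" using pos by (simp only: mult_less_cancel_right_pos)
    then show "(1 - t) * k1 < 1" using pos by (simp add: k1_def)
  qed
  have mob_quot: "mob ((c + d) / d) z = (c + d) * z / (c * z + d)" if "0 < d" for c d z :: real
  proof -
    have "d * (1 - z + (c + d) / d * z) = c * z + d"
      using that by (simp add: field_simps)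
    then have "mob ((c + d) / d) z = (d * ((c + d) / d * z)) / (c * z + d)"
      unfolding mob_def using that by (metis mult_divide_mult_cancel_left less_irrefl)
    then show ?thesis using that by simp
  qed
  have Phi0: "Phi A0 z = t * mob k0 z" for z
    using pos by (simp add: Phi_def A(1) b0 k0_def mob_quot a0')
  have Phi1: "Phi A1 z = t + (1 - t) * mob k1 z" if "0 \<le> z" "z \<le> 1" for z
  proof -
    have "d1 * (1 - z + k1 * z) = c1 * z + d1"
      using pos by (simp add: k1_def field_simps)
    moreover have "0 < d1 * (1 - z + k1 * z)"
      using pos k_pos that by (intro mult_pos_pos convex_comb_pos)
    ultimately have e: "0 < c1 * z + d1" by simp
    have "Phi A1 z = (t * (c1 * z + d1) + (1 - t) * ((c1 + d1) * z)) / (c1 * z + d1)"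
      by (simp add: Phi_def A(2) a1 b1 algebra_simps)
    also have "\<dots> = t + (1 - t) * ((c1 + d1) * z / (c1 * z + d1))"
      using e by (simp add: add_divide_distrib)
    finally show ?thesis using pos by (simp add: k1_def mob_quot)
  qed
  have dR: "f ` {0..1} \<subseteq> {0..1}" "continuous_on {0..1} f" "strict_mono_on {0..1} f"
    "\<And>x. 0 \<le> x \<Longrightarrow> x \<le> 1/2 \<Longrightarrow> f x = Phi A0 (f (2 * x))"
    "\<And>x. 1/2 \<le> x \<Longrightarrow> x \<le> 1 \<Longrightarrow> f x = Phi A1 (f (2 * x - 1))"
    using A(12) by (auto simp: de_rham_function_def)
  have sol: "solution f"
    unfolding solution_def
  proof (intro conjI allI impI dR(1,2))
    fix x :: real
    show "f x = t * mob k0 (f (2 * x))" if "0 \<le> x \<and> x \<le> 1/2"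
      using dR(4)[of x] that unfolding Phi0 by blast
    show "f x = t + (1 - t) * mob k1 (f (2 * x - 1))" if "1/2 \<le> x \<and> x \<le> 1"
    proof -
      have "f (2 * x - 1) \<in> {0..1}"
        by (rule subsetD[OF dR(1) imageI]) (use that in auto)
      then show ?thesis using dR(5)[of x] that by (subst Phi1[symmetric]) auto
    qed
  qed
  have mono: "mono_on {0..1} f"
    using dR(3) by (rule strict_mono_on_imp_mono_on)
  have P_iff: "?P \<longleftrightarrow> 2 * t * k0 = 1"
  proof -
    \<comment> \<open>The quadratic condition factors, and \<open>a0 < c0 + d0\<close> rules out the
      second factor. For \<open>?Q\<close> the inequality \<open>b1 < d1\<close> plays the same
      part.\<close>
    have "?P \<longleftrightarrow> (2 * a0 - d0) * (a0 - (c0 + d0)) = 0"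
      by (auto simp: algebra_simps)
    also have "\<dots> \<longleftrightarrow> 2 * a0 = d0" using \<open>a0 < c0 + d0\<close> by auto
    also have "\<dots> \<longleftrightarrow> 2 * t * k0 = 1"
    proof -
      have "2 * t * k0 = 2 * a0 / d0" using pos by (simp add: t_def k0_def)
      then show ?thesis using pos by auto
    qed
    finally show ?thesis .
  qed
  have Q_iff: "?Q \<longleftrightarrow> k1 = 2 * (1 - t)"
  proof -
    have "?Q \<longleftrightarrow> (d1 - b1) * (d1 - 2 * b1 - c1) = 0"
      by (auto simp: a1 algebra_simps)
    also have "\<dots> \<longleftrightarrow> c1 + d1 = 2 * (d1 - b1)" using \<open>b1 < d1\<close> by auto
    also have "\<dots> \<longleftrightarrow> k1 = 2 * (1 - t)"
      using pos by (simp add: b1 k1_def field_simps)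
    finally show ?thesis .
  qed
  show ?thesis
  proof (intro conjI impI)
    let ?\<rho> = "\<lambda>x. ennreal ((1 + 2 * (c0 / d0)) / (- 2 * (c0 / d0) * x + 1 + 2 * (c0 / d0))\<^sup>2)"
    assume PQ: "?P \<and> ?Q"
    then have bal: "2 * t * k0 = 1" "k1 = 2 * (1 - t)" using P_iff Q_iff by auto
    define v where "v = t / (1 - t)"
    \<comment> \<open>The ratio \<open>c0 / d0\<close> is invariant under scaling of the matrix, as
      \<open>Phi\<close> is, and becomes \<open>c0\<close> when \<open>d0 = 1\<close>. The balance
      equation \<open>2 * t * k0 = 1\<close> turns \<open>w = 2 * k0 - 1\<close> into
      \<open>1 / v\<close>.\<close>
    define w where "w = 1 + 2 * (c0 / d0)"
    have v: "0 < v" using t by (simp add: v_def)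
    have w: "w = 1 / v"
    proof -
      have w_k0: "w = 2 * k0 - 1" using pos by (simp add: w_def k0_def field_simps)
      have "t * w = 2 * t * k0 - t" unfolding w_k0 by (simp add: algebra_simps)
      then have "t * w = 1 - t" by (simp add: bal(1))
      then show ?thesis using t by (simp add: v_def field_simps)
    qed
    have mu: "mu_of f = density lborel01 (\<lambda>x. ennreal (v / (1 - x + v * x)\<^sup>2))"
      using solution_unique[OF sol solution_mob[OF bal]]
      by (intro mu_of_mob v) (simp add: v_def)
    have "v / (1 - x + v * x)\<^sup>2
        = (1 + 2 * (c0 / d0)) / (- 2 * (c0 / d0) * x + 1 + 2 * (c0 / d0))\<^sup>2" for x
    proof -
      have "- 2 * k * x + 1 + 2 * k = (1 + 2 * k) * (1 - x) + x" for k :: real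
        by (simp add: algebra_simps)
      then have "- 2 * (c0 / d0) * x + 1 + 2 * (c0 / d0) = w * (1 - x) + x"
        unfolding w_def .
      also have "\<dots> = (1 - x + v * x) / v"
        using v by (simp add: w add_divide_distrib)
      finally have "- 2 * (c0 / d0) * x + 1 + 2 * (c0 / d0) = (1 - x + v * x) / v" .
      then have "(1 + 2 * (c0 / d0)) / (- 2 * (c0 / d0) * x + 1 + 2 * (c0 / d0))\<^sup>2
          = (1 / v) / ((1 - x + v * x) / v)\<^sup>2"
        using w unfolding w_def by simp
      also have "\<dots> = v / (1 - x + v * x)\<^sup>2"
        using v by (simp add: power_divide power2_eq_square)
      finally show ?thesis ..
    qed
    then show "mu_of f = density lborel01 ?\<rho>" unfolding mu by simp
    then show "absolutely_continuous lborel01 (mu_of f)"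
      by (simp add: absolutely_continuousI_density measurable_restrict_space1)
  next
    assume "\<not> ?P \<or> \<not> ?Q"
    then have "2 * t * k0 \<noteq> 1 \<or> k1 \<noteq> 2 * (1 - t)" using P_iff Q_iff by auto
    then obtain K where K: "K \<in> sets (mu_of f)" "emeasure (mu_of f) K = 1" "hausdorff_dim K < 1"
      "emeasure lborel K = 0"
      using unbalanced_imp_small_dim[OF sol mono] by blast
    then show "\<exists>K1\<in>sets (mu_of f). emeasure (mu_of f) K1 = 1 \<and> hausdorff_dim K1 < 1" by blast
    have "emeasure (mu_of f) (space (mu_of f)) = 1"
      using emeasure_mu_of_Icc[OF dR(2) mono solution_endpoints[OF sol], of 1] solution_endpoints[OF sol]
      by simp
    then have "emeasure (mu_of f) (space (mu_of f) - K) = 0"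
      using K by (subst emeasure_compl) auto
    moreover have "emeasure lborel01 K = 0"
      using K by (simp add: mem_sets_mu_of emeasure_lborel01)
    ultimately show "mutually_singular lborel01 (mu_of f)"
      unfolding mutually_singular_def using K(1) sets_mu_of[of f] by auto
  qed
qed

end
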